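(* Let $d\ge 1$, $\alpha\in(0,\tfrac12)$ and $\beta>0$. For every integer $p\ge 1$ there is a constant $\tilde C(\alpha,p)<\infty$ (for the fixed value of $\beta$; not depending on the cuboid $\Lambda$, on $\epsilon$ or on $v$) such that for every cuboid $\Lambda\subset\mathbb{Z}^d$, every $\epsilon>0$ and every $v\in\mathcal{D}_p$, $$\left\langle(\phi\cdot v)^{2p}\right\rangle_{\alpha,\Lambda,\epsilon}\le \tilde C(\alpha,p)\,[v;G^p_\Lambda v]^{p}.$$ (The letter $p$ in the symbols $\mathcal{D}_p$ and $G^p_\Lambda$ stands for "periodic" and is not the integer $p$.)
   Context: Let $\Lambda\subset\mathbb{Z}^d$ be a cuboid with side lengths $N=(N_1,\dots,N_d)$. The torus graph $\mathbb{T}_N$ has vertex set $\Lambda$, and its edge set $E(\mathbb{T}_N)$ consists of the (undirected) nearest-neighbour edges inside $\Lambda$ together with the additional edges joining vertices $x,y$ on opposite faces of the cuboid, i.e. $y_i-x_i=N_i$ for some $i$ and $y_l=x_l$ for $l\ne i$ (here $\Lambda=\prod_i\{a_i,\dots,a_i+N_i\}$). Edges are written $jk=\{j,k\}$. For $0<\alpha<1$ let $f_\alpha$ be the unique positive density on $(0,\infty)$ with $\int_0^\infty e^{-\lambda x}f_\alpha(x)\,dx=e^{-\lambda^\alpha}$ for $\lambda\ge 0$. For $\epsilon>0$ put, for $\phi\in\mathbb{R}^\Lambda$ and $t\in\mathbb{R}^{E(\mathbb{T}_N)}$, $$A^p(\phi,t)=\sum_{jk\in E(\mathbb{T}_N)}\bigl(1+\beta(\phi_j-\phi_k)^2\bigr)e^{t_{jk}}+\epsilon\sum_{j\in\Lambda}\phi_j^2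 ,$$ and let $\hat\mu^p_{\Lambda,\epsilon}$ be the probability measure on $\mathbb{R}^\Lambda\times\mathbb{R}^{E(\mathbb{T}_N)}$ $$\hat\mu^p_{\Lambda,\epsilon}(d\phi,dt)=\frac1{Z^p_{\Lambda,\epsilon}(\alpha)}\,e^{-A^p(\phi,t)}\prod_{jk\in E(\mathbb{T}_N)}\bigl(f_\alpha(e^{t_{jk}})e^{t_{jk}}dt_{jk}\bigr)\prod_{j\in\Lambda}d\phi_j ,$$ with $Z^p_{\Lambda,\epsilon}(\alpha)$ the normalizing constant. $\langle\cdot\rangle_{\alpha,\Lambda,\epsilon}$ is expectation with respect to $\hat\mu^p_{\Lambda,\epsilon}$. (Its $\phi$-marginal is the measure proportional to $\exp\{-\sum_{jk\in E(\mathbb{T}_N)}(1+\beta(\phi_j-\phi_k)^2)^\alpha-\epsilon\sum_j\phi_j^2\}\prod_j d\phi_j$.) $[v;w]=v\cdot w=\sum_{j\in\Lambda}v_jw_j$. The periodic lattice Laplacian $-\Delta^p_\Lambda$ is the symmetric operator on $\mathbb{R}^\Lambda$ with quadratic form $[\phi;-\Delta^p_\Lambda\phi]=\sum_{jk\in E(\mathbb{T}_N)}(\phi_j-\phi_k)^2$. $\mathcal{D}_p=\{v\in\mathbb{R}^\Lambda:\ \sum_{j}v_j=0\}$, and $G^p_\Lambda=(-\Delta^p_\Lambda)^{-1}$ is the inverse of $-\Delta^p_\Lambda$ on $\mathcal{D}_p$. *)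

theory Defs
  imports "HOL-Probability.Probability"
begin

text \<open>
  The lattice \<open>\<int>\<^sup>d\<close> is \<^typ>\<open>int ^ 'd\<close>, so \<open>d = CARD('d) \<ge> 1\<close>.
  Elements of \<open>\<real>\<^sup>\<Lambda>\<close> are the extensional functions on \<open>\<Lambda>\<close>, which is also
  the carrier of the product measure \<^const>\<open>PiM\<close>.
\<close>

definition cuboid :: "int ^ 'd \<Rightarrow> nat ^ 'd \<Rightarrow> (int ^ 'd) set" where
  "cuboid a N = {x. \<forall>i. a $ i \<le> x $ i \<and> x $ i \<le> a $ i + int (N $ i)}"

definition nearest_neighbours :: "int ^ 'd \<Rightarrow> int ^ 'd \<Rightarrow> bool" where
  "nearest_neighbours x y \<longleftrightarrow> (\<Sum>i\<in>UNIV. \<bar>x $ i - y $ i\<bar>) = 1"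

definition opposite :: "nat ^ 'd \<Rightarrow> int ^ 'd \<Rightarrow> int ^ 'd \<Rightarrow> bool" where
  "opposite N x y \<longleftrightarrow> (\<exists>i. y $ i - x $ i = int (N $ i) \<and> (\<forall>l. l \<noteq> i \<longrightarrow> y $ l = x $ l))"

text \<open>
  An edge \<open>jk\<close> is the set \<open>{j, k}\<close>, so there are no multiple edges: for \<open>N\<^sub>i = 1\<close> the
  two kinds of edges in direction \<open>i\<close> coincide.  The condition \<open>x \<noteq> y\<close> matters only in
  degenerate directions \<open>N\<^sub>i = 0\<close>, where it excludes loops.
\<close>

definition torus_edges :: "int ^ 'd \<Rightarrow> nat ^ 'd \<Rightarrow> (int ^ 'd) set set" where
  "torus_edges a N = {{x, y} | x y. x \<in> cuboid a N \<and> y \<in> cuboid a N \<and> x \<noteq> y \<and>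
     (nearest_neighbours x y \<or> opposite N x y)}"

text \<open>
  \<open>(\<phi>\<^sub>j - \<phi>\<^sub>k)\<^sup>2\<close> as a function of the unordered pair \<open>{j, k}\<close>; both orders occur in the
  double sum, whence the factor \<open>1/2\<close>.
\<close>

definition grad_sq :: "('v \<Rightarrow> real) \<Rightarrow> 'v set \<Rightarrow> real" where
  "grad_sq \<phi> e = (\<Sum>j\<in>e. \<Sum>k\<in>e. (\<phi> j - \<phi> k)\<^sup>2) / 2"

lemma grad_sq_edge: "grad_sq \<phi> {j, k} = (\<phi> j - \<phi> k)\<^sup>2"
  by (cases "j = k") (simp_all add: grad_sq_def power2_commute)

definition dot :: "'v set \<Rightarrow> ('v \<Rightarrow> real) \<Rightarrow> ('v \<Rightarrow> real) \<Rightarrow> real" where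
  "dot \<Lambda> v w = (\<Sum>j\<in>\<Lambda>. v j * w j)"

definition neg_laplacian :: "int ^ 'd \<Rightarrow> nat ^ 'd \<Rightarrow> (int ^ 'd \<Rightarrow> real) \<Rightarrow> int ^ 'd \<Rightarrow> real" where
  "neg_laplacian a N \<phi> =
     (\<lambda>j\<in>cuboid a N. \<Sum>k | k \<in> cuboid a N \<and> {j, k} \<in> torus_edges a N. \<phi> j - \<phi> k)"

definition mean_zero :: "'v set \<Rightarrow> ('v \<Rightarrow> real) set" where
  "mean_zero \<Lambda> = {v \<in> \<Lambda> \<rightarrow>\<^sub>E UNIV. (\<Sum>j\<in>\<Lambda>. v j) = 0}"

definition green :: "int ^ 'd \<Rightarrow> nat ^ 'd \<Rightarrow> (int ^ 'd \<Rightarrow> real) \<Rightarrow> int ^ 'd \<Rightarrow> real" where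
  "green a N = the_inv_into (mean_zero (cuboid a N)) (neg_laplacian a N)"

text \<open>
  The Laplace transform determines the density only up to null sets, and values of \<open>f\<close>
  outside \<open>(0, \<infinity>)\<close> are irrelevant; the measure below does not depend on these choices.
  For \<open>s = 0\<close> the condition is the normalisation, since \<open>0 powr \<alpha> = 0\<close>.
\<close>

definition stable_density :: "real \<Rightarrow> (real \<Rightarrow> real) \<Rightarrow> bool" where
  "stable_density \<alpha> f \<longleftrightarrow>
     set_borel_measurable borel {0<..} f \<and> (\<forall>x>0. f x > 0) \<and>
     (\<forall>s\<ge>0. (LINT x:{0<..}|lborel. exp (- s * x) * f x) = exp (- (s powr \<alpha>)))"

definition action ::
    "real \<Rightarrow> real \<Rightarrow> int ^ 'd \<Rightarrow> nat ^ 'd \<Rightarrow> (int ^ 'd \<Rightarrow> real) \<Rightarrow> ((int ^ 'd) set \<Rightarrow> real) \<Rightarrow> real" where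
  "action \<beta> \<epsilon> a N \<phi> t =
     (\<Sum>e\<in>torus_edges a N. (1 + \<beta> * grad_sq \<phi> e) * exp (t e)) + \<epsilon> * (\<Sum>j\<in>cuboid a N. (\<phi> j)\<^sup>2)"

definition reference_measure ::
    "int ^ 'd \<Rightarrow> nat ^ 'd \<Rightarrow> ((int ^ 'd \<Rightarrow> real) \<times> ((int ^ 'd) set \<Rightarrow> real)) measure" where
  "reference_measure a N =
     (\<Pi>\<^sub>M j\<in>cuboid a N. lborel) \<Otimes>\<^sub>M (\<Pi>\<^sub>M e\<in>torus_edges a N. lborel)"

definition weight ::
    "(real \<Rightarrow> real) \<Rightarrow> real \<Rightarrow> real \<Rightarrow> int ^ 'd \<Rightarrow> nat ^ 'd \<Rightarrow>
     (int ^ 'd \<Rightarrow> real) \<times> ((int ^ 'd) set \<Rightarrow> real) \<Rightarrow> real" where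
  "weight f \<beta> \<epsilon> a N = (\<lambda>(\<phi>, t).
     exp (- action \<beta> \<epsilon> a N \<phi> t) * (\<Prod>e\<in>torus_edges a N. f (exp (t e)) * exp (t e)))"

definition partition_function ::
    "(real \<Rightarrow> real) \<Rightarrow> real \<Rightarrow> real \<Rightarrow> int ^ 'd \<Rightarrow> nat ^ 'd \<Rightarrow> ennreal" where
  "partition_function f \<beta> \<epsilon> a N =
     (\<integral>\<^sup>+ \<omega>. ennreal (weight f \<beta> \<epsilon> a N \<omega>) \<partial>reference_measure a N)"

definition gibbs_measure ::
    "(real \<Rightarrow> real) \<Rightarrow> real \<Rightarrow> real \<Rightarrow> int ^ 'd \<Rightarrow> nat ^ 'd \<Rightarrow>
     ((int ^ 'd \<Rightarrow> real) \<times> ((int ^ 'd) set \<Rightarrow> real)) measure" where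
  "gibbs_measure f \<beta> \<epsilon> a N = density (reference_measure a N)
     (\<lambda>\<omega>. ennreal (weight f \<beta> \<epsilon> a N \<omega>) / partition_function f \<beta> \<epsilon> a N)"

text \<open>
  The Laplacian above is the symmetric operator with quadratic form
  \<open>\<Sum>\<^bsub>jk\<^esub> (\<phi>\<^sub>j - \<phi>\<^sub>k)\<^sup>2\<close>:
\<close>

lemma finite_cuboid: "finite (cuboid a N)"
proof -
  have "cuboid a N \<subseteq> vec_lambda ` (\<Pi>\<^sub>E i\<in>UNIV. {a $ i .. a $ i + int (N $ i)})"
  proof
    fix x assume "x \<in> cuboid a N"
    then have "vec_nth x \<in> (\<Pi>\<^sub>E i\<in>UNIV. {a $ i .. a $ i + int (N $ i)})"
      by (auto simp: cuboid_def PiE_def)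
    then show "x \<in> vec_lambda ` (\<Pi>\<^sub>E i\<in>UNIV. {a $ i .. a $ i + int (N $ i)})"
      by (metis image_eqI vec_nth_inverse)
  qed
  then show ?thesis
    by (rule finite_subset) (intro finite_imageI finite_PiE, auto)
qed

lemma torus_edges_subset: "e \<in> torus_edges a N \<Longrightarrow> e \<subseteq> cuboid a N"
  by (auto simp: torus_edges_def)

lemma finite_torus_edges: "finite (torus_edges a N)"
  by (rule finite_subset[of _ "Pow (cuboid a N)"])
    (auto dest: torus_edges_subset simp: finite_cuboid)

lemma dot_neg_laplacian:
  "dot (cuboid a N) \<psi> (neg_laplacian a N \<phi>) =
     (\<Sum>j\<in>cuboid a N. \<Sum>k\<in>cuboid a N.
        if {j, k} \<in> torus_edges a N then \<psi> j * (\<phi> j - \<phi> k) else 0)"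
  by (auto simp: dot_def neg_laplacian_def sum_distrib_left finite_cuboid sum.If_cases
      intro!: sum.cong)

lemma neg_laplacian_polarized:
  "2 * dot (cuboid a N) \<psi> (neg_laplacian a N \<phi>) =
     (\<Sum>j\<in>cuboid a N. \<Sum>k\<in>cuboid a N.
        if {j, k} \<in> torus_edges a N then (\<psi> j - \<psi> k) * (\<phi> j - \<phi> k) else 0)"
proof -
  let ?c = "\<lambda>j k. {j, k} \<in> torus_edges a N"
  have "dot (cuboid a N) \<psi> (neg_laplacian a N \<phi>) =
     (\<Sum>k\<in>cuboid a N. \<Sum>j\<in>cuboid a N. if ?c j k then \<psi> j * (\<phi> j - \<phi> k) else 0)"
    unfolding dot_neg_laplacian by (rule sum.swap)
  also have "\<dots> = (\<Sum>j\<in>cuboid a N. \<Sum>k\<in>cuboid a N. if ?c j k then \<psi> k * (\<phi> k - \<phi> j) else 0)"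
    by (simp add: insert_commute)
  finally have "2 * dot (cuboid a N) \<psi> (neg_laplacian a N \<phi>) =
     (\<Sum>j\<in>cuboid a N. \<Sum>k\<in>cuboid a N. if ?c j k then \<psi> j * (\<phi> j - \<phi> k) else 0) +
     (\<Sum>j\<in>cuboid a N. \<Sum>k\<in>cuboid a N. if ?c j k then \<psi> k * (\<phi> k - \<phi> j) else 0)"
    using dot_neg_laplacian[of a N \<psi> \<phi>] by simp
  also have "\<dots> = (\<Sum>j\<in>cuboid a N. \<Sum>k\<in>cuboid a N.
        if ?c j k then (\<psi> j - \<psi> k) * (\<phi> j - \<phi> k) else 0)"
    unfolding sum.distrib[symmetric]
    by (intro sum.cong refl) (auto simp: algebra_simps)
  finally show ?thesis .
qed

lemma neg_laplacian_symmetric: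
  "dot (cuboid a N) \<psi> (neg_laplacian a N \<phi>) = dot (cuboid a N) (neg_laplacian a N \<psi>) \<phi>"
proof -
  have "dot (cuboid a N) \<psi> (neg_laplacian a N \<phi>) = dot (cuboid a N) \<phi> (neg_laplacian a N \<psi>)"
  proof -
    have "2 * dot (cuboid a N) \<psi> (neg_laplacian a N \<phi>) =
        2 * dot (cuboid a N) \<phi> (neg_laplacian a N \<psi>)"
      unfolding neg_laplacian_polarized by (intro sum.cong refl) (simp add: mult.commute)
    then show ?thesis by simp
  qed
  then show ?thesis by (simp add: dot_def mult.commute)
qed

lemma neg_laplacian_quadratic_form:
  "dot (cuboid a N) \<phi> (neg_laplacian a N \<phi>) = (\<Sum>e\<in>torus_edges a N. grad_sq \<phi> e)"
proof -
  let ?V = "cuboid a N" and ?E = "torus_edges a N"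
  have "2 * (\<Sum>e\<in>?E. grad_sq \<phi> e) = (\<Sum>e\<in>?E. \<Sum>j\<in>e. \<Sum>k\<in>e. (\<phi> j - \<phi> k)\<^sup>2)"
    unfolding sum_distrib_left grad_sq_def by simp
  also have "\<dots> = (\<Sum>e\<in>?E. \<Sum>j\<in>?V. \<Sum>k\<in>?V. if j \<in> e \<and> k \<in> e then (\<phi> j - \<phi> k)\<^sup>2 else 0)"
  proof (rule sum.cong[OF refl])
    fix e assume "e \<in> ?E"
    then have e: "e \<subseteq> ?V" by (rule torus_edges_subset)
    have "(\<Sum>k\<in>?V. if j \<in> e \<and> k \<in> e then (\<phi> j - \<phi> k)\<^sup>2 else 0) =
        (if j \<in> e then \<Sum>k\<in>e. (\<phi> j - \<phi> k)\<^sup>2 else 0)" for j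
      using e by (simp add: sum.If_cases finite_cuboid Int_absorb1)
    then show "(\<Sum>j\<in>e. \<Sum>k\<in>e. (\<phi> j - \<phi> k)\<^sup>2) =
        (\<Sum>j\<in>?V. \<Sum>k\<in>?V. if j \<in> e \<and> k \<in> e then (\<phi> j - \<phi> k)\<^sup>2 else 0)"
      using e by (simp add: sum.If_cases finite_cuboid Int_absorb1)
  qed
  also have "\<dots> = (\<Sum>j\<in>?V. \<Sum>k\<in>?V. \<Sum>e\<in>?E. if j \<in> e \<and> k \<in> e then (\<phi> j - \<phi> k)\<^sup>2 else 0)"
    by (subst sum.swap) (intro sum.cong refl sum.swap)
  also have "\<dots> = (\<Sum>j\<in>?V. \<Sum>k\<in>?V. if {j, k} \<in> ?E then (\<phi> j - \<phi> k) * (\<phi> j - \<phi> k) else 0)"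
  proof (intro sum.cong refl)
    fix j k
    show "(\<Sum>e\<in>?E. if j \<in> e \<and> k \<in> e then (\<phi> j - \<phi> k)\<^sup>2 else 0) =
        (if {j, k} \<in> ?E then (\<phi> j - \<phi> k) * (\<phi> j - \<phi> k) else 0)"
    proof (cases "j = k")
      case False
      then have "j \<in> e \<and> k \<in> e \<longleftrightarrow> e = {j, k}" if "e \<in> ?E" for e
        using that by (auto simp: torus_edges_def)
      then have "(\<Sum>e\<in>?E. if j \<in> e \<and> k \<in> e then (\<phi> j - \<phi> k)\<^sup>2 else 0) =
          (\<Sum>e\<in>?E. if e = {j, k} then (\<phi> j - \<phi> k)\<^sup>2 else 0)"
        by (intro sum.cong) auto
      then show ?thesis
        by (simp add: finite_torus_edges power2_eq_square)
    qed (auto intro!: sum.neutral)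
  qed
  also have "\<dots> = 2 * dot ?V \<phi> (neg_laplacian a N \<phi>)"
    by (simp only: neg_laplacian_polarized)
  finally show ?thesis by simp
qed

end

theory Submission
  imports Defs "HOL-Real_Asymp.Real_Asymp"
begin

text \<open>
  Put \<open>c e = \<beta> * exp (t e)\<close>.  For fixed \<open>t\<close> the field \<open>\<phi>\<close> is Gaussian with energy
  \<open>\<Sum>e. c e * (\<nabla>\<^sub>e \<phi>)\<^sup>2 + \<epsilon> * \<Sum>j. (\<phi> j)\<^sup>2\<close>, and it remains to average Gaussian moments over the random
  conductances \<open>c\<close>.

  Let \<open>u\<close> be the Green function applied to \<open>v\<close>.  Summation by parts gives \<open>\<phi> \<cdot> v = \<Sum>e. \<nabla>\<^sub>e \<phi> * \<nabla>\<^sub>e u\<close>, so by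
  Cauchy-Schwarz \<open>(\<phi> \<cdot> v)\<^sup>2\<close> is at most \<open>K = \<Sum>e. (\<nabla>\<^sub>e u)\<^sup>2 / c e\<close> times the energy.  For a Gaussian this forces the
  \<open>2p\<close>-th moment of \<open>\<phi> \<cdot> v\<close> to be at most a constant times \<open>K ^ p\<close> (lemma \<open>gauss_moment\<close>, by completing the
  square).  Since \<open>\<Sum>e. (\<nabla>\<^sub>e u)\<^sup>2 = [v; G v]\<close>, Jensen's inequality reduces the theorem to a bound on the
  expectation of \<open>exp (- p * t e)\<close> for a single edge \<open>e\<close>, uniform in everything but \<open>\<alpha>\<close> and \<open>p\<close>.

  Integrating out \<open>\<phi>\<close> gives \<open>t\<close> a density proportional to the product of one-edge densities and the Gaussian
  normalisation \<open>Z c\<close>.  As a function of one conductance, with the others arbitrary but fixed,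
  \<open>Z\<close> is decreasing, and it loses at most a universal factor when that conductance is doubled, since
  the new part of the energy is of order one with positive probability (lemma \<open>gauss_doubling\<close>).  Hence
  \<open>Z\<close> grows at most like a fixed power of the inverse conductance as the conductance goes to \<open>0\<close>
  (lemma \<open>Z_small_conductance\<close>).  Conditionally on the other edges, the expectation of
  \<open>exp (- p * t e)\<close> is therefore bounded by a ratio of one-dimensional integrals in which the other edges
  no longer appear (lemma \<open>edge_moment\<close>).

  That ratio is finite because the stable density has all negative moments, which follows from the rapid
  decay of its Laplace transform \<open>exp (- (s powr \<alpha>))\<close> (lemma \<open>stable_density_negative_moment\<close>).
\<close>

section \<open>Linear functionals and positive definite forms\<close>

text \<open>
  Points of \<open>\<real>\<^sup>V\<close> are functions on the whole vertex type, and the product measure lives on the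
  extensional ones.  The last clause makes a functional insensitive to the values outside \<open>V\<close>, so
  that pointwise sums and multiples, which leave the extensional functions, cause no harm.
\<close>

definition linear_on :: "'v set \<Rightarrow> (('v \<Rightarrow> real) \<Rightarrow> real) \<Rightarrow> bool" where
  "linear_on V l \<longleftrightarrow>
     (\<forall>x y. l (\<lambda>i. x i + y i) = l x + l y) \<and>
     (\<forall>c x. l (\<lambda>i. c * x i) = c * l x) \<and>
     (\<forall>x y. (\<forall>i\<in>V. x i = y i) \<longrightarrow> l x = l y)"

lemma linear_onI:
  assumes "\<And>x y. l (\<lambda>i. x i + y i) = l x + l y"
    and "\<And>c x. l (\<lambda>i. c * x i) = c * l x"
    and "\<And>x y. (\<And>i. i \<in> V \<Longrightarrow> x i = y i) \<Longrightarrow> l x = l y"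
  shows "linear_on V l"
  using assms unfolding linear_on_def by blast

lemma linear_on_add: "linear_on V l \<Longrightarrow> l (\<lambda>i. x i + y i) = l x + l y"
  and linear_on_scale: "linear_on V l \<Longrightarrow> l (\<lambda>i. c * x i) = c * l x"
  by (simp_all add: linear_on_def)

lemma linear_on_cong: "linear_on V l \<Longrightarrow> (\<And>i. i \<in> V \<Longrightarrow> x i = y i) \<Longrightarrow> l x = l y"
  by (auto simp: linear_on_def)

lemma linear_on_diff: "linear_on V l \<Longrightarrow> l (\<lambda>i. x i - y i) = l x - l y"
  using linear_on_add[of V l x "\<lambda>i. (-1) * y i"] linear_on_scale[of V l "-1" y] by simp

lemma linear_on_zero: "linear_on V l \<Longrightarrow> (\<And>i. i \<in> V \<Longrightarrow> x i = 0) \<Longrightarrow> l x = 0"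
  using linear_on_scale[of V l 0 x] linear_on_cong[of V l x "\<lambda>i. 0 * x i"] by simp

lemma linear_on_mult: "linear_on V l \<Longrightarrow> linear_on V (\<lambda>x. c * l x)"
  unfolding linear_on_def by (metis distrib_left mult.left_commute)

lemma linear_on_expand:
  assumes "finite V" and l: "linear_on V l"
  shows "l x = (\<Sum>i\<in>V. x i * l (\<lambda>j. of_bool (j = i)))"
proof -
  have "J \<subseteq> V \<Longrightarrow> l (\<lambda>j. if j \<in> J then x j else 0) = (\<Sum>i\<in>J. x i * l (\<lambda>j. of_bool (j = i)))"
    if "finite J" for J
    using that
  proof (induction J)
    case empty
    then show ?case using linear_on_zero[OF l] by simp
  next
    case (insert k J)
    have "l (\<lambda>j. if j \<in> insert k J then x j else 0) =
        l (\<lambda>j. x k * of_bool (j = k) + (if j \<in> J then x j else 0))"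
      using insert by (intro linear_on_cong[OF l]) auto
    also have "\<dots> = x k * l (\<lambda>j. of_bool (j = k)) + l (\<lambda>j. if j \<in> J then x j else 0)"
      using linear_on_add[OF l, of "\<lambda>j. x k * of_bool (j = k)"] linear_on_scale[OF l, of "x k"]
      by simp
    finally show ?case using insert by simp
  qed
  from this[OF assms(1) order_refl] show ?thesis
    using linear_on_cong[OF l, of x "\<lambda>j. if j \<in> V then x j else 0"] by simp
qed

lemma linear_on_measurable:
  assumes "finite V" and "linear_on V l"
  shows "l \<in> borel_measurable (\<Pi>\<^sub>M i\<in>V. lborel)"
proof -
  have "(\<lambda>x. \<Sum>i\<in>V. x i * l (\<lambda>j. of_bool (j = i))) \<in> borel_measurable (\<Pi>\<^sub>M i\<in>V. lborel)"
    by measurable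
  then show ?thesis
    by (simp add: linear_on_expand[OF assms, symmetric])
qed

text \<open>
  The form serves twice: its Gaussian weight \<open>exp (- B x x)\<close> gives the law of the field, and its
  nondegeneracy solves linear equations, in particular the one for the Green function.
\<close>

locale energy_form =
  fixes V :: "'v set" and B :: "('v \<Rightarrow> real) \<Rightarrow> ('v \<Rightarrow> real) \<Rightarrow> real"
  assumes finite: "finite V"
    and linear: "linear_on V (\<lambda>x. B x z)"
    and sym: "B x y = B y x"
    and pos: "(\<exists>i\<in>V. x i \<noteq> 0) \<Longrightarrow> 0 < B x x"
begin

lemma linear_right: "linear_on V (B z)"
proof -
  have "B z = (\<lambda>x. B x z)" by (rule ext) (rule sym)
  then show ?thesis using linear[of z] by metis
qed

lemmas left_simps = linear_on_add[OF linear] linear_on_diff[OF linear] linear_on_scale[OF linear]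
lemmas right_simps = linear_on_add[OF linear_right] linear_on_diff[OF linear_right]
  linear_on_scale[OF linear_right]

lemma nonneg: "0 \<le> B x x"
proof (cases "\<exists>i\<in>V. x i \<noteq> 0")
  case True
  then show ?thesis by (intro less_imp_le pos)
next
  case False
  then have "B x x = 0" by (intro linear_on_zero[OF linear]) blast
  then show ?thesis by simp
qed

lemma cong: "(\<And>i. i \<in> V \<Longrightarrow> x i = y i) \<Longrightarrow> B x x = B y y"
  using linear_on_cong[OF linear, of x y x] linear_on_cong[OF linear_right, of x y y] by simp

text \<open>
  Gram-Schmidt.  To pass from \<open>J\<close> to \<open>insert j J\<close>, subtract from the \<open>j\<close>-th unit vector its
  \<open>B\<close>-projection to the functions supported in \<open>J\<close>.  The result \<open>g\<close> is \<open>B\<close>-orthogonal to those functions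
  and nonzero, since \<open>g j = 1\<close>, so a multiple of \<open>g\<close> corrects the representer found for \<open>J\<close>.
\<close>

lemma riesz_supported:
  assumes "finite J" and "J \<subseteq> V" and "linear_on V l"
  shows "\<exists>w. (\<forall>i\<in>V - J. w i = 0) \<and> (\<forall>x. (\<forall>i\<in>V - J. x i = 0) \<longrightarrow> B x w = l x)"
  using assms
proof (induction J arbitrary: l)
  case empty
  then have "\<forall>x. (\<forall>i\<in>V - {}. x i = 0) \<longrightarrow> B x (\<lambda>i. 0) = l x"
    using linear_on_zero[OF linear] linear_on_zero[OF empty(2)] by simp
  then show ?case by (intro exI[of _ "\<lambda>i. 0"]) simp
next
  case (insert j J)
  then have j: "j \<in> V - J" and J: "J \<subseteq> V" by auto
  define d :: "'v \<Rightarrow> real" where "d = (\<lambda>i. of_bool (i = j))"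
  obtain w where w0: "\<And>i. i \<in> V - J \<Longrightarrow> w i = 0"
    and w: "\<And>x. (\<forall>i\<in>V - J. x i = 0) \<Longrightarrow> B x w = l x"
    using insert.IH[OF J insert.prems(2)] by blast
  obtain h where h0: "\<And>i. i \<in> V - J \<Longrightarrow> h i = 0"
    and h: "\<And>x. (\<forall>i\<in>V - J. x i = 0) \<Longrightarrow> B x h = B x d"
    using insert.IH[OF J linear[of d]] by blast
  define g where "g = (\<lambda>i. d i - h i)"
  have gj: "g j = 1" using j h0 by (simp add: g_def d_def)
  have g0: "g i = 0" if "i \<in> V - insert j J" for i
    using that h0 by (simp add: g_def d_def)
  have gg: "0 < B g g"
  proof (rule pos)
    show "\<exists>i\<in>V. g i \<noteq> 0" using gj j by (intro bexI[of _ j]) simp_all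
  qed
  define c where "c = (l g - B g w) / B g g"
  define w' where "w' = (\<lambda>i. w i + c * g i)"
  have "B x w' = l x" if x: "\<forall>i\<in>V - insert j J. x i = 0" for x
  proof -
    define y where "y = (\<lambda>i. x i - x j * g i)"
    have y0: "\<forall>i\<in>V - J. y i = 0"
    proof
      fix i assume "i \<in> V - J"
      then show "y i = 0"
        using x g0[of i] gj by (cases "i = j") (auto simp: y_def)
    qed
    have eq: "x = (\<lambda>i. y i + x j * g i)" by (simp add: y_def)
    have "B y g = 0"
      using h[OF y0] by (simp add: g_def right_simps)
    then have "B y w' = l y"
      using w[OF y0] by (simp add: w'_def right_simps)
    moreover have "B g w' = l g"
    proof -
      have "B g w' = B g w + c * B g g" by (simp add: w'_def right_simps)
      then show ?thesis using gg by (simp add: c_def)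
    qed
    ultimately show ?thesis
      using left_simps(1)[of y "\<lambda>i. x j * g i" w'] left_simps(3)[of "x j" g w']
        linear_on_add[OF insert.prems(2), of y "\<lambda>i. x j * g i"]
        linear_on_scale[OF insert.prems(2), of "x j" g]
      by (simp flip: eq)
  qed
  moreover have "\<forall>i\<in>V - insert j J. w' i = 0"
    using w0 g0 by (auto simp: w'_def)
  ultimately show ?case by blast
qed

lemma riesz:
  assumes "linear_on V l"
  obtains w where "\<And>x. B x w = l x"
  using riesz_supported[OF finite order_refl assms] by auto

text \<open>
  A linear functional is a polynomial in the coordinates, hence measurable on the product space; so
  is the energy, by expanding one argument.
\<close>

lemma measurable_energy: "(\<lambda>x. B x x) \<in> borel_measurable (\<Pi>\<^sub>M i\<in>V. lborel)"
proof -
  have "(\<lambda>x. \<Sum>i\<in>V. x i * B (\<lambda>j. of_bool (j = i)) x) \<in> borel_measurable (\<Pi>\<^sub>M i\<in>V. lborel)"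
    by (intro borel_measurable_sum borel_measurable_times
        linear_on_measurable[OF finite linear_right]) simp
  then show ?thesis
    by (subst linear_on_expand[OF finite linear])
qed

end

section \<open>Gaussian integrals without determinants\<close>

lemma nn_integral_PiM_translate:
  fixes w :: "'v \<Rightarrow> real"
  assumes V: "finite V" and F: "F \<in> borel_measurable (\<Pi>\<^sub>M i\<in>V. lborel)"
  shows "(\<integral>\<^sup>+x. F (\<lambda>i\<in>V. x i + w i) \<partial>(\<Pi>\<^sub>M i\<in>V. lborel)) = (\<integral>\<^sup>+x. F x \<partial>(\<Pi>\<^sub>M i\<in>V. lborel))"
proof -
  interpret product_sigma_finite "\<lambda>_::'v. lborel :: real measure" by standard
  let ?M = "\<Pi>\<^sub>M i\<in>V. (lborel :: real measure)" and ?T = "\<lambda>x. \<lambda>i\<in>V. x i + w i"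
  have T: "?T \<in> measurable ?M ?M" by measurable
  \<comment> \<open>It suffices to compare both measures on boxes.\<close>
  have "distr ?M ?M ?T = ?M"
  proof (rule PiM_eqI[OF V])
    fix A :: "'v \<Rightarrow> real set" assume A: "\<And>i. i \<in> V \<Longrightarrow> A i \<in> sets lborel"
    have "emeasure (distr ?M ?M ?T) (Pi\<^sub>E V A) = emeasure ?M (?T -` Pi\<^sub>E V A \<inter> space ?M)"
      using A T V by (intro emeasure_distr) auto
    also have "?T -` Pi\<^sub>E V A \<inter> space ?M = Pi\<^sub>E V (\<lambda>i. (\<lambda>y. y + w i) -` A i)"
      by (auto simp: space_PiM PiE_def Pi_def extensional_def)
    also have "emeasure ?M \<dots> = (\<Prod>i\<in>V. emeasure lborel ((\<lambda>y. y + w i) -` A i))"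
    proof (rule emeasure_PiM[OF V])
      fix i assume "i \<in> V"
      with A have "A i \<in> sets borel" by simp
      then show "(\<lambda>y. y + w i) -` A i \<in> sets lborel"
        using measurable_sets[of "\<lambda>y. y + w i" borel borel "A i"] by simp
    qed
    also have "\<dots> = (\<Prod>i\<in>V. emeasure lborel (A i))"
    proof (rule prod.cong[OF refl])
      fix i assume "i \<in> V"
      with A have "A i \<in> sets borel" by simp
      then have "emeasure (distr lborel borel ((+) (w i))) (A i) =
          emeasure lborel ((\<lambda>y. y + w i) -` A i)"
        by (subst emeasure_distr) (auto simp: add.commute vimage_def)
      then show "emeasure lborel ((\<lambda>y. y + w i) -` A i) = emeasure lborel (A i)"
        by (simp add: lborel_distr_plus)
    qed
    finally show "emeasure (distr ?M ?M ?T) (Pi\<^sub>E V A) = (\<Prod>i\<in>V. emeasure lborel (A i))" .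
  qed simp
  then show ?thesis
    using nn_integral_distr[OF T, of F] F by simp
qed

lemma cosh_ge_sum:
  assumes "finite I" and "\<And>n. n \<in> I \<Longrightarrow> even n"
  shows "(\<Sum>n\<in>I. x ^ n / fact n) \<le> cosh (x::real)"
proof -
  let ?c = "\<lambda>n. if even n then x ^ n /\<^sub>R fact n else 0"
  have "(\<Sum>n\<in>I. x ^ n / fact n) = sum ?c I"
    using assms(2) by (intro sum.cong) (auto simp: divide_inverse mult.commute)
  also have "\<dots> \<le> suminf ?c"
    by (rule sum_le_suminf[OF sums_summable[OF cosh_converges[of x]] assms(1)])
      (auto simp: zero_le_even_power)
  also have "\<dots> = cosh x" by (rule sums_unique[OF cosh_converges, symmetric])
  finally show ?thesis .
qed

lemma even_power_le_cosh: "x ^ (2 * p) \<le> fact (2 * p) * cosh (x::real)"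
  using cosh_ge_sum[of "{2 * p}" x] by (simp add: field_simps)

lemma cosh_ge_quadratic: "1 + x\<^sup>2 / 2 \<le> cosh (x::real)"
proof -
  have "(\<Sum>n\<in>{0, 2}. x ^ n / fact n) \<le> cosh x" by (rule cosh_ge_sum) auto
  then show ?thesis by simp
qed

lemma exp_quarter_le: "exp (1 / 4) \<le> (4 / 3 :: real)"
proof (rule ccontr)
  assume "\<not> ?thesis"
  then have "(4 / 3 :: real) ^ 4 \<le> exp (1 / 4) ^ 4" by (intro power_mono) auto
  also have "exp (1 / 4 :: real) ^ 4 = exp 1" by (simp add: exp_of_nat_mult[symmetric])
  also have "\<dots> \<le> 3" by (rule exp_le)
  finally show False by (simp add: power_numeral_reduce)
qed

text \<open>
  The coefficient \<open>1 / 2\<close> of \<open>cosh x\<close> is what matters: together with the factor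
  \<open>exp (1 / 4) \<le> 4 / 3\<close> from the Gaussian integral of \<open>cosh\<close> it gives \<open>2 / 3 < 1\<close>, which is then absorbed.
\<close>

lemma one_le_gauss_plus_cosh: "1 \<le> 5 * exp (- x\<^sup>2) + cosh x / (2::real)"
proof (cases "x\<^sup>2 \<le> 2")
  case True
  have "exp 2 = exp 1 * exp (1::real)" by (simp add: exp_add[symmetric])
  also have "\<dots> \<le> 3 * 3" by (intro mult_mono exp_le) auto
  finally have "1 / 9 \<le> exp (- 2 :: real)" by (simp add: exp_minus field_simps)
  also have "\<dots> \<le> exp (- x\<^sup>2)" using True by simp
  finally show ?thesis using cosh_real_ge_1[of x] by linarith
next
  case False
  then show ?thesis using cosh_ge_quadratic[of x] exp_gt_zero[of "- x\<^sup>2"] by linarith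
qed

lemma ennreal_lincomb:
  "0 \<le> a \<Longrightarrow> 0 \<le> b \<Longrightarrow> 0 \<le> x \<Longrightarrow> 0 \<le> y \<Longrightarrow>
    ennreal a * ennreal x + ennreal b * ennreal y = ennreal (a * x + b * y)"
  by (simp add: ennreal_mult)

lemma borel_measurable_cosh [measurable]: "cosh \<in> borel_measurable (borel :: real measure)"
  by (intro borel_measurable_continuous_onI continuous_intros)

context energy_form
begin

definition gauss :: ennreal where
  "gauss = (\<integral>\<^sup>+x. ennreal (exp (- B x x)) \<partial>(\<Pi>\<^sub>M i\<in>V. lborel))"

text \<open>
  Completing the square.  If \<open>w\<close> represents \<open>l\<close>, the translation by \<open>w / 2\<close> turns \<open>l x - B x x\<close> into
  \<open>B w w / 4 - B x x\<close>.  Applied to \<open>w\<close> itself the bound says \<open>(B w w)\<^sup>2 \<le> K * B w w\<close>, whence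
  \<open>B w w \<le> K\<close>.  So the bound does not see the dimension.
\<close>

lemma nn_integral_exp_linear:
  assumes l: "linear_on V l" and bound: "\<And>x. (l x)\<^sup>2 \<le> K * B x x" and "0 \<le> K"
  shows "(\<integral>\<^sup>+x. ennreal (exp (l x - B x x)) \<partial>(\<Pi>\<^sub>M i\<in>V. lborel)) \<le> ennreal (exp (K / 4)) * gauss"
proof -
  let ?M = "\<Pi>\<^sub>M i\<in>V. (lborel :: real measure)"
  note [measurable] = measurable_energy linear_on_measurable[OF finite l]
  obtain w where w: "\<And>x. B x w = l x" using riesz[OF l] by blast
  have "(B w w)\<^sup>2 \<le> K * B w w" using bound[of w] w by simp
  then have q: "B w w \<le> K"
    using nonneg[of w] \<open>0 \<le> K\<close> by (cases "B w w = 0") (auto simp: power2_eq_square)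
  define h where "h = (\<lambda>i. (1 / 2) * w i)"
  have Bh: "B x h = l x / 2" for x
    using right_simps(3)[of x "1 / 2" w] by (simp add: h_def w)
  have shift: "l (\<lambda>i\<in>V. x i + h i) - B (\<lambda>i\<in>V. x i + h i) (\<lambda>i\<in>V. x i + h i) = B w w / 4 - B x x" for x
  proof -
    have lh: "l h = B w w / 2"
      using linear_on_scale[OF l, of "1 / 2" w] by (simp add: h_def w)
    have "l (\<lambda>i\<in>V. x i + h i) = l (\<lambda>i. x i + h i)"
      by (intro linear_on_cong[OF l]) simp
    also have "\<dots> = l x + B w w / 2"
      by (simp add: linear_on_add[OF l] lh)
    finally have 1: "l (\<lambda>i\<in>V. x i + h i) = l x + B w w / 2" .
    have "B (\<lambda>i\<in>V. x i + h i) (\<lambda>i\<in>V. x i + h i) = B (\<lambda>i. x i + h i) (\<lambda>i. x i + h i)"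
      by (intro cong) simp
    also have "\<dots> = B x x + 2 * B x h + B h h"
      using sym[of h x] by (simp add: left_simps(1) right_simps(1))
    also have "\<dots> = B x x + l x + B w w / 4"
      using lh by (simp add: Bh)
    finally show ?thesis using 1 by simp
  qed
  have "(\<integral>\<^sup>+x. ennreal (exp (l x - B x x)) \<partial>?M) =
      (\<integral>\<^sup>+x. ennreal (exp (l (\<lambda>i\<in>V. x i + h i) - B (\<lambda>i\<in>V. x i + h i) (\<lambda>i\<in>V. x i + h i))) \<partial>?M)"
    by (rule nn_integral_PiM_translate[OF finite, symmetric]) measurable
  also have "\<dots> = (\<integral>\<^sup>+x. ennreal (exp (B w w / 4)) * ennreal (exp (- B x x)) \<partial>?M)"
    unfolding shift by (simp add: ennreal_mult[symmetric] exp_add[symmetric])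
  also have "\<dots> = ennreal (exp (B w w / 4)) * gauss"
    unfolding gauss_def by (rule nn_integral_cmult) measurable
  also have "\<dots> \<le> ennreal (exp (K / 4)) * gauss"
    using q by (intro mult_right_mono ennreal_leI) auto
  finally show ?thesis .
qed

lemma nn_integral_cosh_linear:
  assumes l: "linear_on V l" and bound: "\<And>x. (l x)\<^sup>2 \<le> K * B x x" and "0 \<le> K"
  shows "(\<integral>\<^sup>+x. ennreal (cosh (l x) * exp (- B x x)) \<partial>(\<Pi>\<^sub>M i\<in>V. lborel))
    \<le> ennreal (exp (K / 4)) * gauss"
proof -
  let ?M = "\<Pi>\<^sub>M i\<in>V. (lborel :: real measure)"
  let ?m = "\<lambda>x. - 1 * l x"
  note [measurable] = measurable_energy linear_on_measurable[OF finite l]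
  have m: "linear_on V ?m" by (rule linear_on_mult[OF l])
  have "(\<integral>\<^sup>+x. ennreal (cosh (l x) * exp (- B x x)) \<partial>?M) =
      (\<integral>\<^sup>+x. ennreal (1 / 2) * (ennreal (exp (l x - B x x)) + ennreal (exp (?m x - B x x))) \<partial>?M)"
  proof (intro nn_integral_cong)
    fix x
    have "cosh (l x) * exp (- B x x) = 1 / 2 * (exp (l x - B x x) + exp (?m x - B x x))"
      by (simp add: cosh_field_def exp_diff exp_minus field_simps)
    then show "ennreal (cosh (l x) * exp (- B x x)) =
        ennreal (1 / 2) * (ennreal (exp (l x - B x x)) + ennreal (exp (?m x - B x x)))"
      by (simp only: ennreal_plus[symmetric] ennreal_mult[symmetric] exp_ge_zero add_nonneg_nonneg
          zero_le_divide_1_iff zero_le_numeral)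
  qed
  also have "\<dots> = ennreal (1 / 2) *
      (\<integral>\<^sup>+x. ennreal (exp (l x - B x x)) + ennreal (exp (?m x - B x x)) \<partial>?M)"
    by (rule nn_integral_cmult) measurable
  also have "\<dots> = ennreal (1 / 2) *
      ((\<integral>\<^sup>+x. ennreal (exp (l x - B x x)) \<partial>?M) + (\<integral>\<^sup>+x. ennreal (exp (?m x - B x x)) \<partial>?M))"
    by (rule arg_cong[where f = "(*) (ennreal (1 / 2))"], rule nn_integral_add) measurable
  also have "\<dots> \<le> ennreal (1 / 2) * (ennreal (exp (K / 4)) * gauss + ennreal (exp (K / 4)) * gauss)"
    using bound \<open>0 \<le> K\<close>
    by (intro mult_left_mono add_mono nn_integral_exp_linear l m) auto
  also have "\<dots> = ennreal (1 / 2 * (exp (K / 4) + exp (K / 4))) * gauss"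
    by (simp only: distrib_right[symmetric] mult.assoc[symmetric] ennreal_plus[symmetric]
        ennreal_mult[symmetric] exp_ge_zero add_nonneg_nonneg zero_le_divide_1_iff zero_le_numeral)
  also have "1 / 2 * (exp (K / 4) + exp (K / 4)) = exp (K / 4)" by simp
  finally show ?thesis .
qed

text \<open>
  The functional rescaled by \<open>1 / sqrt K\<close> satisfies the previous bound with constant 1, and
  \<open>cosh\<close> dominates the even powers.
\<close>

lemma gauss_moment:
  assumes l: "linear_on V l" and bound: "\<And>x. (l x)\<^sup>2 \<le> K * B x x" and K: "0 \<le> K" and p: "1 \<le> p"
  shows "(\<integral>\<^sup>+x. ennreal (l x ^ (2 * p) * exp (- B x x)) \<partial>(\<Pi>\<^sub>M i\<in>V. lborel))
    \<le> ennreal (2 * fact (2 * p) * K ^ p) * gauss"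
proof (cases "K = 0")
  case True
  then have "l x = 0" for x using bound[of x] by simp
  then show ?thesis using p by (simp add: power_0_left)
next
  case False
  with K have K: "0 < K" by simp
  let ?M = "\<Pi>\<^sub>M i\<in>V. (lborel :: real measure)"
  note [measurable] = measurable_energy linear_on_measurable[OF finite l]
  let ?m = "\<lambda>x. (1 / sqrt K) * l x"
  have m: "linear_on V ?m" by (rule linear_on_mult[OF l])
  have mb: "(?m x)\<^sup>2 \<le> 1 * B x x" for x
    using bound[of x] K by (simp add: power_divide field_simps)
  have "l x ^ (2 * p) * exp (- B x x) \<le> (K ^ p * fact (2 * p)) * (cosh (?m x) * exp (- B x x))" for x
  proof -
    have "l x ^ (2 * p) = K ^ p * ?m x ^ (2 * p)"
      using K by (simp add: power_mult power_divide)
    also have "\<dots> \<le> K ^ p * (fact (2 * p) * cosh (?m x))"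
      using K by (intro mult_left_mono even_power_le_cosh) auto
    finally show ?thesis by (simp add: mult.assoc[symmetric] mult_right_mono)
  qed
  then have "(\<integral>\<^sup>+x. ennreal (l x ^ (2 * p) * exp (- B x x)) \<partial>?M) \<le>
      (\<integral>\<^sup>+x. ennreal (K ^ p * fact (2 * p)) * ennreal (cosh (?m x) * exp (- B x x)) \<partial>?M)"
    using K by (intro nn_integral_mono) (simp add: ennreal_mult[symmetric] ennreal_leI del: times_divide_eq_left)
  also have "\<dots> = ennreal (K ^ p * fact (2 * p)) * (\<integral>\<^sup>+x. ennreal (cosh (?m x) * exp (- B x x)) \<partial>?M)"
    by (rule nn_integral_cmult) measurable
  also have "\<dots> \<le> ennreal (K ^ p * fact (2 * p)) * (ennreal (exp (1 / 4)) * gauss)"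
    by (intro mult_left_mono nn_integral_cosh_linear[OF m mb]) auto
  also have "\<dots> \<le> ennreal (K ^ p * fact (2 * p)) * (ennreal 2 * gauss)"
    using exp_quarter_le by (intro mult_left_mono mult_right_mono ennreal_leI) auto
  also have "\<dots> = (ennreal (K ^ p * fact (2 * p)) * ennreal 2) * gauss"
    by (simp only: mult.assoc)
  also have "ennreal (K ^ p * fact (2 * p)) * ennreal 2 = ennreal (2 * fact (2 * p) * K ^ p)"
    using K by (subst ennreal_mult[symmetric]) (auto simp: mult_ac)
  finally show ?thesis .
qed

text \<open>
  Adding \<open>(l x)\<^sup>2\<close> to an energy that already dominates it costs only a universal factor, because
  under the Gaussian weight \<open>l\<close> is of order one with positive probability.  Integrating
  \<open>1 \<le> 5 * exp (- (l x)\<^sup>2) + cosh (l x) / 2\<close> expresses this; finiteness of \<open>gauss\<close> permits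
  subtracting \<open>2 / 3 * gauss\<close> from both sides.
\<close>

lemma gauss_doubling:
  assumes l: "linear_on V l" and bound: "\<And>x. (l x)\<^sup>2 \<le> B x x" and fin: "gauss < \<infinity>"
  shows "gauss \<le> 16 * (\<integral>\<^sup>+x. ennreal (exp (- (B x x + (l x)\<^sup>2))) \<partial>(\<Pi>\<^sub>M i\<in>V. lborel))"
    (is "_ \<le> 16 * ?Z")
proof -
  let ?M = "\<Pi>\<^sub>M i\<in>V. (lborel :: real measure)"
  note [measurable] = measurable_energy linear_on_measurable[OF finite l]
  have "exp (- B x x) \<le> 5 * exp (- (B x x + (l x)\<^sup>2)) + 1 / 2 * (cosh (l x) * exp (- B x x))" for x
    using mult_right_mono[OF one_le_gauss_plus_cosh[of "l x"], of "exp (- B x x)"]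
    by (simp add: field_simps exp_add[symmetric])
  then have "ennreal (exp (- B x x)) \<le> ennreal 5 * ennreal (exp (- (B x x + (l x)\<^sup>2))) +
      ennreal (1 / 2) * ennreal (cosh (l x) * exp (- B x x))" for x
    by (subst ennreal_lincomb) (simp_all only: exp_ge_zero zero_le_numeral ennreal_leI
        zero_le_divide_1_iff cosh_real_nonneg mult_nonneg_nonneg)
  then have "gauss \<le> (\<integral>\<^sup>+x. ennreal 5 * ennreal (exp (- (B x x + (l x)\<^sup>2))) +
      ennreal (1 / 2) * ennreal (cosh (l x) * exp (- B x x)) \<partial>?M)"
    unfolding gauss_def by (rule nn_integral_mono)
  also have "\<dots> = ennreal 5 * ?Z +
      ennreal (1 / 2) * (\<integral>\<^sup>+x. ennreal (cosh (l x) * exp (- B x x)) \<partial>?M)"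
    by (subst nn_integral_add; (subst nn_integral_cmult)?; (subst nn_integral_cmult)?) measurable
  also have "\<dots> \<le> ennreal 5 * ?Z + ennreal (1 / 2) * (ennreal (exp (1 / 4)) * gauss)"
    using bound by (intro add_left_mono mult_left_mono nn_integral_cosh_linear l) auto
  also have "\<dots> \<le> ennreal 5 * ?Z + ennreal (1 / 2) * (ennreal (4 / 3) * gauss)"
    using exp_quarter_le by (intro add_left_mono mult_left_mono mult_right_mono ennreal_leI) auto
  also have "\<dots> = ennreal 5 * ?Z + ennreal (2 / 3) * gauss"
    by (subst mult.assoc[symmetric], subst ennreal_mult[symmetric]) simp_all
  finally have le: "gauss \<le> ennreal 5 * ?Z + ennreal (2 / 3) * gauss" .
  show ?thesis
  proof (cases "?Z")
    case top
    then show ?thesis by (simp add: ennreal_mult_top)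
  next
    case (real z)
    obtain g where g: "gauss = ennreal g" "0 \<le> g" using fin by (cases gauss) auto
    have "ennreal g \<le> ennreal 5 * ennreal z + ennreal (2 / 3) * ennreal g"
      using le unfolding g real .
    also have "\<dots> = ennreal (5 * z + 2 / 3 * g)"
      using g real by (intro ennreal_lincomb) auto
    finally have "g \<le> 5 * z + 2 / 3 * g"
      using g real by (subst (asm) ennreal_le_iff) auto
    then have "g \<le> 16 * z" using g real by linarith
    then have "ennreal g \<le> ennreal (16 * z)" by (rule ennreal_leI)
    then show ?thesis using g real by (simp add: ennreal_mult)
  qed
qed

end

section \<open>Random conductance networks\<close>

text \<open>
  The functional \<open>g e\<close> is the gradient across the edge \<open>e\<close>, and \<open>\<epsilon>\<close> is the mass.
\<close>

locale network =
  fixes V :: "'v set" and E :: "'e set" and g :: "'e \<Rightarrow> ('v \<Rightarrow> real) \<Rightarrow> real" and \<epsilon> :: real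
  assumes finite_V: "finite V" and finite_E: "finite E"
    and linear_g: "e \<in> E \<Longrightarrow> linear_on V (g e)" and eps: "0 < \<epsilon>"
begin

text \<open>
  The Dirichlet form for the edge conductances \<open>c\<close>, made definite by the mass.
\<close>

definition form :: "('e \<Rightarrow> real) \<Rightarrow> ('v \<Rightarrow> real) \<Rightarrow> ('v \<Rightarrow> real) \<Rightarrow> real" where
  "form c x y = (\<Sum>e\<in>E. c e * (g e x * g e y)) + \<epsilon> * (\<Sum>j\<in>V. x j * y j)"

text \<open>
  A multiple of the inverse square root of the determinant of \<open>form c\<close>; all estimates below work with
  the integral instead.
\<close>

definition Z :: "('e \<Rightarrow> real) \<Rightarrow> ennreal" where
  "Z c = (\<integral>\<^sup>+x. ennreal (exp (- form c x x)) \<partial>(\<Pi>\<^sub>M i\<in>V. lborel))"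

lemma mass_le_form:
  assumes "\<And>e. e \<in> E \<Longrightarrow> 0 \<le> c e"
  shows "\<epsilon> * (\<Sum>j\<in>V. x j * x j) \<le> form c x x"
  using assms by (auto simp: form_def intro!: sum_nonneg)

lemma energy_form_form:
  assumes c: "\<And>e. e \<in> E \<Longrightarrow> 0 \<le> c e"
  shows "energy_form V (form c)"
proof
  show "finite V" by (rule finite_V)
  show "form c x y = form c y x" for x y
    by (simp add: form_def mult.commute)
  show "linear_on V (\<lambda>x. form c x z)" for z
  proof (rule linear_onI)
    show "form c (\<lambda>i. x i + y i) z = form c x z + form c y z" for x y
      by (simp add: form_def linear_on_add[OF linear_g] distrib_left distrib_right sum.distrib)
    show "form c (\<lambda>i. k * x i) z = k * form c x z" for k x
      by (simp add: form_def linear_on_scale[OF linear_g] distrib_left sum_distrib_left mult_ac)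
    show "form c x z = form c y z" if "\<And>i. i \<in> V \<Longrightarrow> x i = y i" for x y
      using that linear_on_cong[OF linear_g, of _ x y] by (simp add: form_def)
  qed
  show "0 < form c x x" if nz: "\<exists>i\<in>V. x i \<noteq> 0" for x
  proof -
    obtain i where "i \<in> V" "x i \<noteq> 0" using nz by blast
    then have "0 < (\<Sum>j\<in>V. x j * x j)"
      using finite_V by (intro sum_pos2[of V i]) (auto simp: zero_less_mult_iff)
    then show ?thesis
      using mass_le_form[of c x] c eps by (smt (verit) mult_pos_pos)
  qed
qed

lemma gauss_form: "(\<And>e. e \<in> E \<Longrightarrow> 0 \<le> c e) \<Longrightarrow> energy_form.gauss V (form c) = Z c"
  by (simp add: energy_form.gauss_def[OF energy_form_form] Z_def)

text \<open>
  The mass term alone gives an integrable upper bound, a product of one-dimensional Gaussians.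
\<close>

lemma Z_finite:
  assumes "\<And>e. e \<in> E \<Longrightarrow> 0 \<le> c e"
  shows "Z c < \<infinity>"
proof -
  interpret product_sigma_finite "\<lambda>_::'v. lborel :: real measure" by standard
  let ?s = "sqrt (1 / (2 * \<epsilon>))"
  have s: "0 < ?s" using eps by simp
  have "exp (- (\<epsilon> * (y * y))) = sqrt (2 * pi * ?s\<^sup>2) * normal_density 0 ?s y" for y
    using eps by (simp add: normal_density_def power2_eq_square)
  then have fin: "(\<integral>\<^sup>+y. ennreal (exp (- (\<epsilon> * (y * y)))) \<partial>lborel) < \<infinity>"
    using integrable_normal_density[OF s, of 0]
    by (auto simp: ennreal_mult nn_integral_cmult integrable_iff_bounded ennreal_mult_less_top)
  have "Z c \<le> (\<integral>\<^sup>+x. (\<Prod>j\<in>V. ennreal (exp (- (\<epsilon> * (x j * x j))))) \<partial>(\<Pi>\<^sub>M i\<in>V. lborel))"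
    unfolding Z_def
  proof (rule nn_integral_mono)
    fix x
    have "exp (- form c x x) \<le> exp (\<Sum>j\<in>V. - (\<epsilon> * (x j * x j)))"
      using mass_le_form[OF assms, where x = x] by (simp add: sum_negf sum_distrib_left)
    also have "\<dots> = (\<Prod>j\<in>V. exp (- (\<epsilon> * (x j * x j))))" by (rule exp_sum[OF finite_V])
    finally show "ennreal (exp (- form c x x)) \<le> (\<Prod>j\<in>V. ennreal (exp (- (\<epsilon> * (x j * x j)))))"
      by (simp add: prod_ennreal ennreal_leI)
  qed
  also have "\<dots> = (\<Prod>j\<in>V. (\<integral>\<^sup>+y. ennreal (exp (- (\<epsilon> * (y * y)))) \<partial>lborel))"
    by (rule product_nn_integral_prod[OF finite_V]) measurable
  also have "\<dots> < \<infinity>"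
    using fin by (auto simp: power_less_top_ennreal)
  finally show ?thesis .
qed

lemma Z_antimono: "(\<And>e. e \<in> E \<Longrightarrow> c e \<le> c' e) \<Longrightarrow> Z c' \<le> Z c"
  unfolding Z_def form_def
  by (intro nn_integral_mono ennreal_leI) (auto intro!: sum_mono mult_right_mono)

lemma Z_cong: "(\<And>e. e \<in> E \<Longrightarrow> c e = c' e) \<Longrightarrow> Z c = Z c'"
  by (intro antisym Z_antimono) auto

lemma form_update:
  assumes "e \<in> E"
  shows "form (c(e := c e + s)) x x = form c x x + s * (g e x)\<^sup>2"
proof -
  have "(\<Sum>e'\<in>E. (c(e := c e + s)) e' * (g e' x * g e' x)) =
      (\<Sum>e'\<in>E. c e' * (g e' x * g e' x) + (if e' = e then s * (g e x)\<^sup>2 else 0))"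
    by (intro sum.cong) (auto simp: power2_eq_square distrib_right)
  then show ?thesis using assms finite_E by (simp add: form_def sum.distrib)
qed

text \<open>
  Doubling the conductance of one edge adds \<open>c e * (g e x)\<^sup>2\<close> to the energy, and this term is
  already present in it.
\<close>

lemma Z_doubling:
  assumes e: "e \<in> E" and c: "\<And>e. e \<in> E \<Longrightarrow> 0 \<le> c e"
  shows "Z c \<le> 16 * Z (c(e := 2 * c e))"
proof -
  interpret energy_form V "form c" by (rule energy_form_form[OF c])
  let ?l = "\<lambda>x. sqrt (c e) * g e x"
  have l2: "(?l x)\<^sup>2 = c e * (g e x)\<^sup>2" for x
    using c[OF e] by (simp add: power_mult_distrib)
  have "(?l x)\<^sup>2 \<le> form c x x" for x
  proof -
    have "c e * (g e x * g e x) \<le> (\<Sum>e\<in>E. c e * (g e x * g e x))"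
      using e finite_E c by (intro member_le_sum) auto
    moreover have "0 \<le> \<epsilon> * (\<Sum>j\<in>V. x j * x j)"
      using eps by (simp add: sum_nonneg)
    ultimately show ?thesis unfolding l2 by (simp add: form_def power2_eq_square)
  qed
  then have "gauss \<le> 16 * (\<integral>\<^sup>+x. ennreal (exp (- (form c x x + (?l x)\<^sup>2))) \<partial>(\<Pi>\<^sub>M i\<in>V. lborel))"
    by (rule gauss_doubling[OF linear_on_mult[OF linear_g[OF e]]])
      (use gauss_form[OF c] Z_finite[OF c] in simp)
  then show ?thesis
    using gauss_form[OF c] form_update[OF e, of c "c e"] by (simp add: l2 Z_def)
qed

lemma Z_doubling_iterated:
  assumes e: "e \<in> E" and c: "\<And>e. e \<in> E \<Longrightarrow> 0 \<le> c e"
  shows "Z c \<le> 16 ^ n * Z (c(e := 2 ^ n * c e))"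
proof (induction n)
  case (Suc n)
  let ?c = "c(e := 2 ^ n * c e)"
  have "Z ?c \<le> 16 * Z (?c(e := 2 * ?c e))"
    using c e by (intro Z_doubling) auto
  then have step: "Z ?c \<le> 16 * Z (c(e := 2 ^ Suc n * c e))"
    by (simp add: mult.assoc)
  note Suc.IH
  also have "16 ^ n * Z ?c \<le> 16 ^ n * (16 * Z (c(e := 2 ^ Suc n * c e)))"
    by (intro mult_left_mono step) simp
  also have "\<dots> = 16 ^ Suc n * Z (c(e := 2 ^ Suc n * c e))"
    by (simp only: power_Suc mult_ac)
  finally show ?case .
qed simp

text \<open>
  About \<open>- \<tau> / ln 2\<close> doublings lead from the conductance \<open>b * exp \<tau>\<close> to at least \<open>b\<close>, so they cost a fixed
  power of \<open>exp (- \<tau>)\<close>.  The constants depend neither on the network nor on the other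
  conductances, which is the source of the uniformity in the volume.
\<close>

lemma Z_small_conductance:
  assumes e: "e \<in> E" and c: "\<And>e. e \<in> E \<Longrightarrow> 0 \<le> c e" and b: "0 \<le> b" and \<tau>: "\<tau> \<le> 0"
  shows "Z (c(e := b * exp \<tau>)) \<le> ennreal (16 * exp (- 4 * \<tau>)) * Z (c(e := b))"
proof -
  \<comment> \<open>The least \<open>n\<close> with \<open>exp (- \<tau>) \<le> 2 ^ n\<close>; by minimality \<open>16 ^ n = (2 ^ n) ^ 4\<close> is not much larger than \<open>exp (- 4 * \<tau>)\<close>.\<close>
  define n where "n = nat \<lceil>- \<tau> / ln 2\<rceil>"
  have "0 \<le> - \<tau> / ln 2" using \<tau> by (simp add: field_simps)
  then have n: "- \<tau> / ln 2 \<le> real n" "real n \<le> - \<tau> / ln 2 + 1"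
    unfolding n_def by linarith+
  have p: "2 ^ n = exp (real n * ln 2)"
    by (simp add: exp_of_nat_mult)
  have n1: "exp (- \<tau>) \<le> 2 ^ n"
    using n(1) unfolding p by (simp add: field_simps)
  have "2 ^ n \<le> exp (ln 2 - \<tau>)"
    using n(2) unfolding p by (simp add: field_simps)
  then have n2: "2 ^ n \<le> 2 * exp (- \<tau>)" by (simp add: exp_diff exp_minus field_simps)
  have "(16::real) ^ n = (2 ^ 4) ^ n" by simp
  also have "\<dots> = (2 ^ n) ^ 4" by (simp only: power_mult[symmetric] mult.commute)
  also have "\<dots> \<le> (2 * exp (- \<tau>)) ^ 4" using n2 by (intro power_mono) auto
  also have "\<dots> = 16 * exp (- 4 * \<tau>)" by (simp add: power_mult_distrib exp_of_nat_mult[symmetric])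
  finally have n3: "(16::real) ^ n \<le> 16 * exp (- 4 * \<tau>)" .
  let ?c = "c(e := b * exp \<tau>)"
  have "Z ?c \<le> 16 ^ n * Z (?c(e := 2 ^ n * ?c e))"
    using c b e by (intro Z_doubling_iterated) auto
  also have "\<dots> \<le> 16 ^ n * Z (c(e := b))"
  proof (intro mult_left_mono Z_antimono)
    have "b * 1 \<le> b * (2 ^ n * exp \<tau>)"
      using n1 b by (intro mult_left_mono) (auto simp: exp_minus field_simps)
    then show "(c(e := b)) e' \<le> (?c(e := 2 ^ n * ?c e)) e'" for e'
      by (simp add: mult_ac)
  qed simp
  also have "\<dots> = ennreal (16 ^ n) * Z (c(e := b))"
    by (simp add: ennreal_power[symmetric])
  also have "\<dots> \<le> ennreal (16 * exp (- 4 * \<tau>)) * Z (c(e := b))"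
    using n3 by (intro mult_right_mono ennreal_leI) auto
  finally show ?thesis .
qed

lemma measurable_weight:
  "(\<lambda>(x, t). ennreal (exp (- form (\<lambda>e. \<beta> * exp (t e)) x x)))
    \<in> borel_measurable ((\<Pi>\<^sub>M i\<in>V. lborel) \<Otimes>\<^sub>M (\<Pi>\<^sub>M e\<in>E. lborel))"
    (is "_ \<in> borel_measurable ?M")
proof -
  have t: "(\<lambda>p. snd p e) \<in> borel_measurable ?M" if "e \<in> E" for e
    using measurable_compose[OF measurable_snd measurable_component_singleton[OF that, of "\<lambda>_. lborel"]]
    by simp
  have x: "(\<lambda>p. fst p i) \<in> borel_measurable ?M" if "i \<in> V" for i
    using measurable_compose[OF measurable_fst measurable_component_singleton[OF that, of "\<lambda>_. lborel"]]
    by simp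
  have gx: "(\<lambda>p. g e (fst p)) \<in> borel_measurable ?M" if "e \<in> E" for e
    by (rule measurable_compose[OF measurable_fst linear_on_measurable[OF finite_V linear_g[OF that]]])
  have "(\<lambda>p. - form (\<lambda>e. \<beta> * exp (snd p e)) (fst p) (fst p)) \<in> borel_measurable ?M"
    unfolding form_def
    by (intro borel_measurable_uminus borel_measurable_add borel_measurable_sum
        borel_measurable_times borel_measurable_const t x gx
        measurable_compose[OF _ borel_measurable_exp])
  then show ?thesis
    unfolding case_prod_beta
    by (intro measurable_compose[OF measurable_compose[OF _ borel_measurable_exp] measurable_ennreal])
qed

lemma measurable_Z:
  "(\<lambda>t. Z (\<lambda>e. \<beta> * exp (t e))) \<in> borel_measurable (\<Pi>\<^sub>M e\<in>E. lborel)"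
proof -
  interpret product_sigma_finite "\<lambda>_::'v. lborel :: real measure" by standard
  interpret V: sigma_finite_measure "\<Pi>\<^sub>M i\<in>V. (lborel :: real measure)"
    by (rule sigma_finite[OF finite_V])
  have "(\<lambda>(t, x). ennreal (exp (- form (\<lambda>e. \<beta> * exp (t e)) x x)))
      \<in> borel_measurable ((\<Pi>\<^sub>M e\<in>E. lborel) \<Otimes>\<^sub>M (\<Pi>\<^sub>M i\<in>V. lborel))"
    using measurable_compose[OF measurable_pair_swap' measurable_weight[of \<beta>]]
    by (simp add: case_prod_beta)
  then show ?thesis unfolding Z_def by (rule V.borel_measurable_nn_integral)
qed

end

section \<open>Moments under random conductances\<close>

lemma convex_on_power_nonneg: "convex_on {0..} (\<lambda>x::real. x ^ n)"
  using convex_power_odd[of n] convex_on_subset[OF convex_power_even[of n], of "{0..}"]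
  by (cases "even n") auto

text \<open>
  Jensen's inequality for the power function and the weights \<open>a e\<close>, cleared of the denominators.
\<close>

lemma weighted_sum_power_le:
  fixes a y :: "'e \<Rightarrow> real"
  assumes "finite E" and a: "\<And>e. e \<in> E \<Longrightarrow> 0 \<le> a e" and y: "\<And>e. e \<in> E \<Longrightarrow> 0 \<le> y e"
  shows "(\<Sum>e\<in>E. a e * y e) ^ Suc n \<le> (\<Sum>e\<in>E. a e) ^ n * (\<Sum>e\<in>E. a e * y e ^ Suc n)"
proof (cases "(\<Sum>e\<in>E. a e) = 0")
  case True
  then have "a e = 0" if "e \<in> E" for e
    using that assms(1) a by (simp add: sum_nonneg_eq_0_iff)
  then show ?thesis by simp
next
  case False
  define A where "A = (\<Sum>e\<in>E. a e)"
  have A: "0 < A" using False a sum_nonneg[of E a] by (auto simp: A_def less_le)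
  have "(\<Sum>e\<in>E. (a e / A) *\<^sub>R y e) ^ Suc n \<le> (\<Sum>e\<in>E. a e / A * y e ^ Suc n)"
  proof (rule convex_on_sum[OF assms(1) _ convex_on_power_nonneg])
    show "E \<noteq> {}" using False by auto
    show "(\<Sum>e\<in>E. a e / A) = 1" using A by (simp add: sum_divide_distrib[symmetric] A_def)
  qed (use a y A in auto)
  then have "(\<Sum>e\<in>E. a e * y e) ^ Suc n / A ^ Suc n \<le> (\<Sum>e\<in>E. a e * y e ^ Suc n) / A"
    by (simp only: real_scaleR_def times_divide_eq_left sum_divide_distrib[symmetric] power_divide)
  then show ?thesis
    using A by (simp add: A_def[symmetric] field_simps)
qed

text \<open>
  \<open>J\<close> stands for the dependence of the Gaussian normalisation on the logarithm \<open>\<tau>\<close> of one conductance.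
  The hypotheses on \<open>J\<close> bound it by \<open>(1 + 16 * exp (- 4 * \<tau>)) * J 0\<close> from above and, for \<open>\<tau> \<le> 0\<close>, by
  \<open>J 0\<close> from below.  The unknown \<open>J 0\<close> therefore cancels, and a comparison of two integrals of \<open>r\<close> alone remains.
\<close>

lemma nn_integral_tilted_le:
  fixes r J :: "real \<Rightarrow> ennreal"
  assumes r[measurable]: "r \<in> borel_measurable lborel"
    and anti: "\<And>\<sigma> \<tau>. \<sigma> \<le> \<tau> \<Longrightarrow> J \<tau> \<le> J \<sigma>"
    and small: "\<And>\<tau>. \<tau> \<le> 0 \<Longrightarrow> J \<tau> \<le> ennreal (16 * exp (- 4 * \<tau>)) * J 0"
    and C: "(\<integral>\<^sup>+\<tau>. r \<tau> * ennreal (exp (- real p * \<tau>) * (1 + 16 * exp (- 4 * \<tau>))) \<partial>lborel)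
      \<le> C * (\<integral>\<^sup>+\<tau>. r \<tau> * indicator {..0} \<tau> \<partial>lborel)"
  shows "(\<integral>\<^sup>+\<tau>. r \<tau> * (ennreal (exp (- real p * \<tau>)) * J \<tau>) \<partial>lborel) \<le> C * (\<integral>\<^sup>+\<tau>. r \<tau> * J \<tau> \<partial>lborel)"
proof -
  let ?w = "\<lambda>\<tau>. exp (- real p * \<tau>) * (1 + 16 * exp (- 4 * \<tau>))"
  have J: "J \<tau> \<le> ennreal (1 + 16 * exp (- 4 * \<tau>)) * J 0" for \<tau>
  proof (cases "\<tau> \<le> 0")
    case True
    from small[OF this] show ?thesis
      by (rule order_trans) (intro mult_right_mono ennreal_leI, auto)
  next
    case False
    then have "J \<tau> \<le> ennreal 1 * J 0" using anti[of 0 \<tau>] by simp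
    then show ?thesis
      by (rule order_trans) (intro mult_right_mono ennreal_leI, auto)
  qed
  have "(\<integral>\<^sup>+\<tau>. r \<tau> * (ennreal (exp (- real p * \<tau>)) * J \<tau>) \<partial>lborel) \<le>
      (\<integral>\<^sup>+\<tau>. r \<tau> * ennreal (?w \<tau>) * J 0 \<partial>lborel)"
  proof (rule nn_integral_mono)
    fix \<tau>
    have "ennreal (exp (- real p * \<tau>)) * J \<tau> \<le>
        ennreal (exp (- real p * \<tau>)) * (ennreal (1 + 16 * exp (- 4 * \<tau>)) * J 0)"
      by (intro mult_left_mono J) simp
    also have "\<dots> = ennreal (?w \<tau>) * J 0"
      by (subst ennreal_mult) (auto simp: mult.assoc add_nonneg_nonneg)
    finally show "r \<tau> * (ennreal (exp (- real p * \<tau>)) * J \<tau>) \<le> r \<tau> * ennreal (?w \<tau>) * J 0"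
      by (simp only: mult.assoc mult_left_mono zero_le)
  qed
  also have "\<dots> = (\<integral>\<^sup>+\<tau>. r \<tau> * ennreal (?w \<tau>) \<partial>lborel) * J 0"
    by (rule nn_integral_multc) measurable
  also have "\<dots> \<le> C * (\<integral>\<^sup>+\<tau>. r \<tau> * indicator {..0} \<tau> \<partial>lborel) * J 0"
    by (intro mult_right_mono C) simp
  also have "\<dots> = C * (\<integral>\<^sup>+\<tau>. r \<tau> * indicator {..0} \<tau> * J 0 \<partial>lborel)"
    by (subst nn_integral_multc) (auto simp: mult.assoc)
  also have "\<dots> \<le> C * (\<integral>\<^sup>+\<tau>. r \<tau> * J \<tau> \<partial>lborel)"
    by (intro mult_left_mono nn_integral_mono)
      (auto simp: indicator_def intro!: mult_left_mono anti)
  finally show ?thesis .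
qed

context network
begin

text \<open>
  Conditionally on the other edges, \<open>t e\<close> has density proportional to \<open>r\<close> times the Gaussian
  normalisation as a function of the conductance of \<open>e\<close>, so that the negative exponential moments of
  \<open>t e\<close> are bounded by constants of the single-edge density \<open>r\<close>.
\<close>

lemma edge_moment:
  fixes r :: "real \<Rightarrow> real"
  assumes e: "e \<in> E" and \<beta>: "0 \<le> \<beta>"
    and r[measurable]: "r \<in> borel_measurable lborel" and r0: "\<And>\<tau>. 0 \<le> r \<tau>"
    and C: "(\<integral>\<^sup>+\<tau>. ennreal (r \<tau>) * ennreal (exp (- real p * \<tau>) * (1 + 16 * exp (- 4 * \<tau>))) \<partial>lborel)
      \<le> C * (\<integral>\<^sup>+\<tau>. ennreal (r \<tau>) * indicator {..0} \<tau> \<partial>lborel)"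
  shows "(\<integral>\<^sup>+t. ennreal (\<Prod>e\<in>E. r (t e)) * (ennreal (exp (- real p * t e)) * Z (\<lambda>e. \<beta> * exp (t e)))
      \<partial>(\<Pi>\<^sub>M e\<in>E. lborel))
    \<le> C * (\<integral>\<^sup>+t. ennreal (\<Prod>e\<in>E. r (t e)) * Z (\<lambda>e. \<beta> * exp (t e)) \<partial>(\<Pi>\<^sub>M e\<in>E. lborel))"
    (is "(\<integral>\<^sup>+t. ?P t * (?w t * ?Z t) \<partial>?M) \<le> _")
proof -
  interpret product_sigma_finite "\<lambda>_::'e. lborel :: real measure" by standard
  define F where "F = E - {e}"
  have F: "finite F" "e \<notin> F" "E = insert e F" using finite_E e by (auto simp: F_def)
  have t: "(\<lambda>t. t e) \<in> borel_measurable ?M" if "e \<in> E" for e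
    using measurable_component_singleton[OF that, of "\<lambda>_. lborel"] by simp
  have P: "?P \<in> borel_measurable ?M"
    by (intro measurable_compose[OF _ measurable_ennreal] borel_measurable_prod
        measurable_compose[OF t, of _ r]) (use r in simp_all)
  have w: "?w \<in> borel_measurable ?M"
    by (intro measurable_compose[OF _ measurable_ennreal] measurable_compose[OF _ borel_measurable_exp]
        borel_measurable_times borel_measurable_const t e)
  note Z = measurable_Z[of \<beta>]
  have split: "(\<integral>\<^sup>+t. h t \<partial>?M) = (\<integral>\<^sup>+x. (\<integral>\<^sup>+y. h (x(e := y)) \<partial>lborel) \<partial>(\<Pi>\<^sub>M e\<in>F. lborel))"
    if "h \<in> borel_measurable ?M" for h
    using product_nn_integral_insert[OF F(1,2), of h] that by (simp add: F(3))
  have P_upd: "?P (x(e := y)) = ennreal (r y) * ennreal (\<Prod>e\<in>F. r (x e))" for x y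
  proof -
    have "(\<Prod>e'\<in>F. r ((x(e := y)) e')) = (\<Prod>e\<in>F. r (x e))"
      using F(2) by (intro prod.cong) auto
    then show ?thesis
      unfolding F(3) using F(1,2) r0 by (simp add: ennreal_mult prod_nonneg)
  qed
  have "(\<integral>\<^sup>+t. ?P t * (?w t * ?Z t) \<partial>?M) =
      (\<integral>\<^sup>+x. (\<integral>\<^sup>+y. ?P (x(e := y)) * (?w (x(e := y)) * ?Z (x(e := y))) \<partial>lborel) \<partial>(\<Pi>\<^sub>M e\<in>F. lborel))"
    by (rule split) (intro borel_measurable_times_ennreal P w Z)
  also have "\<dots> \<le> (\<integral>\<^sup>+x. C * (\<integral>\<^sup>+y. ?P (x(e := y)) * ?Z (x(e := y)) \<partial>lborel) \<partial>(\<Pi>\<^sub>M e\<in>F. lborel))"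
  proof (rule nn_integral_mono)
    fix x :: "'e \<Rightarrow> real"
    \<comment> \<open>The densities of the other edges are a constant here, and as a factor of \<open>?J\<close> they respect its two hypotheses.\<close>
    let ?J = "\<lambda>y. ennreal (\<Prod>e\<in>F. r (x e)) * ?Z (x(e := y))"
    let ?c = "\<lambda>e. \<beta> * exp (x e)"
    have Z_upd: "?Z (x(e := y)) = Z (?c(e := \<beta> * exp y))" for y
      by (rule Z_cong) auto
    have "(\<integral>\<^sup>+y. ennreal (r y) * (ennreal (exp (- real p * y)) * ?J y) \<partial>lborel)
        \<le> C * (\<integral>\<^sup>+y. ennreal (r y) * ?J y \<partial>lborel)"
    proof (rule nn_integral_tilted_le[OF _ _ _ C])
      show "?J \<tau> \<le> ?J \<sigma>" if "\<sigma> \<le> \<tau>" for \<sigma> \<tau>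
        using that \<beta> by (intro mult_left_mono Z_antimono) (auto intro: mult_left_mono)
      show "?J \<tau> \<le> ennreal (16 * exp (- 4 * \<tau>)) * ?J 0" if "\<tau> \<le> 0" for \<tau>
      proof -
        have "?Z (x(e := \<tau>)) \<le> ennreal (16 * exp (- 4 * \<tau>)) * ?Z (x(e := 0))"
          unfolding Z_upd using Z_small_conductance[OF e _ \<beta> that, of ?c] \<beta> by simp
        then have "?J \<tau> \<le> ennreal (\<Prod>e\<in>F. r (x e)) * (ennreal (16 * exp (- 4 * \<tau>)) * ?Z (x(e := 0)))"
          by (intro mult_left_mono) simp_all
        then show ?thesis by (simp only: mult_ac)
      qed
    qed measurable
    then show "(\<integral>\<^sup>+y. ?P (x(e := y)) * (?w (x(e := y)) * ?Z (x(e := y))) \<partial>lborel) \<le>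
        C * (\<integral>\<^sup>+y. ?P (x(e := y)) * ?Z (x(e := y)) \<partial>lborel)"
      unfolding P_upd by (simp add: mult_ac)
  qed
  also have "\<dots> = C * (\<integral>\<^sup>+x. (\<integral>\<^sup>+y. ?P (x(e := y)) * ?Z (x(e := y)) \<partial>lborel) \<partial>(\<Pi>\<^sub>M e\<in>F. lborel))"
  proof (rule nn_integral_cmult)
    have [measurable]: "(\<lambda>t. ?P t * ?Z t) \<in> borel_measurable (\<Pi>\<^sub>M e\<in>insert e F. lborel)"
      unfolding F(3)[symmetric] by (intro borel_measurable_times_ennreal P Z)
    interpret lborel: sigma_finite_measure "lborel :: real measure" by standard
    have "(\<lambda>(x, y). ?P (x(e := y)) * ?Z (x(e := y)))
        \<in> borel_measurable ((\<Pi>\<^sub>M e\<in>F. lborel) \<Otimes>\<^sub>M lborel)"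
      using measurable_compose[OF measurable_add_dim[of e F "\<lambda>_. lborel"], of "\<lambda>t. ?P t * ?Z t" borel]
      by (simp add: case_prod_beta)
    then show "(\<lambda>x. \<integral>\<^sup>+y. ?P (x(e := y)) * ?Z (x(e := y)) \<partial>lborel)
        \<in> borel_measurable (\<Pi>\<^sub>M e\<in>F. lborel)"
      by (rule lborel.borel_measurable_nn_integral)
  qed
  also have "(\<integral>\<^sup>+x. (\<integral>\<^sup>+y. ?P (x(e := y)) * ?Z (x(e := y)) \<partial>lborel) \<partial>(\<Pi>\<^sub>M e\<in>F. lborel)) =
      (\<integral>\<^sup>+t. ?P t * ?Z t \<partial>?M)"
    by (rule split[symmetric]) (intro borel_measurable_times_ennreal P Z)
  finally show ?thesis .
qed

text \<open>
  Moments for given conductances.  By Cauchy-Schwarz the square of \<open>\<Sum>e\<in>E. g e x * g e u\<close> is at most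
  the energy of \<open>x\<close> times \<open>\<Sum>e\<in>E. (g e u)\<^sup>2 / c e\<close>, the energy of the flow \<open>g e u\<close> through resistances
  \<open>1 / c e\<close> (Thomson's principle).
\<close>

lemma quenched_moment:
  assumes c: "\<And>e. e \<in> E \<Longrightarrow> 0 < c e" and p: "1 \<le> p"
  shows "(\<integral>\<^sup>+x. ennreal ((\<Sum>e\<in>E. g e x * g e u) ^ (2 * p) * exp (- form c x x)) \<partial>(\<Pi>\<^sub>M i\<in>V. lborel))
    \<le> ennreal (2 * fact (2 * p) * (\<Sum>e\<in>E. (g e u)\<^sup>2 / c e) ^ p) * Z c"
proof -
  have c0: "\<And>e. e \<in> E \<Longrightarrow> 0 \<le> c e" using c less_imp_le by blast
  interpret energy_form V "form c" by (rule energy_form_form[OF c0])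
  let ?l = "\<lambda>x. \<Sum>e\<in>E. g e x * g e u" and ?K = "\<Sum>e\<in>E. (g e u)\<^sup>2 / c e"
  have l: "linear_on V ?l"
  proof (rule linear_onI)
    show "?l (\<lambda>i. x i + y i) = ?l x + ?l y" for x y
      by (simp add: linear_on_add[OF linear_g] distrib_right sum.distrib)
    show "?l (\<lambda>i. k * x i) = k * ?l x" for k x
      by (simp add: linear_on_scale[OF linear_g] sum_distrib_left mult.assoc)
    show "?l x = ?l y" if "\<And>i. i \<in> V \<Longrightarrow> x i = y i" for x y
      using that linear_on_cong[OF linear_g, of _ x y] by simp
  qed
  have K: "0 \<le> ?K" using c0 by (intro sum_nonneg divide_nonneg_nonneg) auto
  have "(?l x)\<^sup>2 \<le> ?K * form c x x" for x
  proof -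
    have "?l x = (\<Sum>e\<in>E. (g e u / sqrt (c e)) * (sqrt (c e) * g e x))"
      using c by (intro sum.cong) (auto simp: less_le)
    then have "(?l x)\<^sup>2 \<le> (\<Sum>e\<in>E. (g e u / sqrt (c e))\<^sup>2) * (\<Sum>e\<in>E. (sqrt (c e) * g e x)\<^sup>2)"
      using Cauchy_Schwarz_ineq_sum by metis
    also have "\<dots> = ?K * (\<Sum>e\<in>E. c e * (g e x * g e x))"
      using c0 by (intro arg_cong2[where f = "(*)"] sum.cong refl)
        (auto simp: power_divide power_mult_distrib power2_eq_square[of "g _ _"])
    also have "\<dots> \<le> ?K * form c x x"
      using eps by (intro mult_left_mono K) (simp add: form_def sum_nonneg)
    finally show ?thesis .
  qed
  from gauss_moment[OF l this K p] show ?thesis using gauss_form[OF c0] by simp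
qed

text \<open>
  Averaging the quenched bound over the conductances.  Jensen's inequality with weights
  \<open>(g e u)\<^sup>2\<close> reduces the \<open>p\<close>-th power of the flow energy to the single-edge moments
  \<open>exp (- p * t e)\<close>, which \<open>edge_moment\<close> controls.
\<close>

lemma annealed_moment:
  fixes r :: "real \<Rightarrow> real"
  assumes \<beta>: "0 < \<beta>" and p: "1 \<le> p"
    and r[measurable]: "r \<in> borel_measurable lborel" and r0: "\<And>\<tau>. 0 \<le> r \<tau>" and C0: "0 \<le> C"
    and C: "(\<integral>\<^sup>+\<tau>. ennreal (r \<tau>) * ennreal (exp (- real p * \<tau>) * (1 + 16 * exp (- 4 * \<tau>))) \<partial>lborel)
      \<le> ennreal C * (\<integral>\<^sup>+\<tau>. ennreal (r \<tau>) * indicator {..0} \<tau> \<partial>lborel)"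
  shows "(\<integral>\<^sup>+t. ennreal (\<Prod>e\<in>E. r (t e)) * (\<integral>\<^sup>+x. ennreal ((\<Sum>e\<in>E. g e x * g e u) ^ (2 * p) *
        exp (- form (\<lambda>e. \<beta> * exp (t e)) x x)) \<partial>(\<Pi>\<^sub>M i\<in>V. lborel)) \<partial>(\<Pi>\<^sub>M e\<in>E. lborel))
    \<le> ennreal (2 * fact (2 * p) / \<beta> ^ p * C * (\<Sum>e\<in>E. (g e u)\<^sup>2) ^ p) *
      (\<integral>\<^sup>+t. ennreal (\<Prod>e\<in>E. r (t e)) * Z (\<lambda>e. \<beta> * exp (t e)) \<partial>(\<Pi>\<^sub>M e\<in>E. lborel))"
    (is "(\<integral>\<^sup>+t. ?P t * ?X t \<partial>?M) \<le> _ * ?I")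
proof -
  let ?Z = "\<lambda>t. Z (\<lambda>e. \<beta> * exp (t e))"
  define G where "G = (\<Sum>e\<in>E. (g e u)\<^sup>2)"
  have G: "0 \<le> G" by (simp add: G_def sum_nonneg)
  obtain n where n: "p = Suc n" using p by (cases p) auto
  define D where "D = 2 * fact (2 * p) / \<beta> ^ p * G ^ n"
  have D: "0 \<le> D" using \<beta> G by (simp add: D_def)
  let ?w = "\<lambda>e t. ?P t * (ennreal (exp (- real p * t e)) * ?Z t)"
  have t: "(\<lambda>t. t e) \<in> borel_measurable ?M" if "e \<in> E" for e
    using measurable_component_singleton[OF that, of "\<lambda>_. lborel"] by simp
  have P: "?P \<in> borel_measurable ?M"
    by (intro measurable_compose[OF _ measurable_ennreal] borel_measurable_prod
        measurable_compose[OF t, of _ r]) (use r in simp_all)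
  have w: "?w e \<in> borel_measurable ?M" if "e \<in> E" for e
    by (intro measurable_compose[OF _ measurable_ennreal] measurable_compose[OF _ borel_measurable_exp]
        borel_measurable_times borel_measurable_times_ennreal borel_measurable_const t that P measurable_Z)
  have "?P t * ?X t \<le> (\<Sum>e\<in>E. ennreal (D * (g e u)\<^sup>2) * ?w e t)" for t
  proof -
    let ?K = "\<Sum>e\<in>E. (g e u)\<^sup>2 / (\<beta> * exp (t e))"
    have "?K ^ p = ((\<Sum>e\<in>E. (g e u)\<^sup>2 * exp (- t e)) / \<beta>) ^ p"
      by (simp add: sum_divide_distrib exp_minus field_simps)
    also have "\<dots> = (\<Sum>e\<in>E. (g e u)\<^sup>2 * exp (- t e)) ^ p / \<beta> ^ p"
      by (rule power_divide)
    also have "\<dots> \<le> (G ^ n * (\<Sum>e\<in>E. (g e u)\<^sup>2 * exp (- t e) ^ p)) / \<beta> ^ p"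
      unfolding n G_def using \<beta> finite_E
      by (intro divide_right_mono weighted_sum_power_le) auto
    finally have "2 * fact (2 * p) * ?K ^ p \<le>
        2 * fact (2 * p) * ((G ^ n * (\<Sum>e\<in>E. (g e u)\<^sup>2 * exp (- t e) ^ p)) / \<beta> ^ p)"
      by (intro mult_left_mono) auto
    also have "\<dots> = D * (\<Sum>e\<in>E. (g e u)\<^sup>2 * exp (- t e) ^ p)"
      by (simp add: D_def)
    also have "\<dots> = (\<Sum>e\<in>E. D * (g e u)\<^sup>2 * exp (- real p * t e))"
      by (simp add: sum_distrib_left mult.assoc exp_of_nat_mult[symmetric])
    finally have K: "ennreal (2 * fact (2 * p) * ?K ^ p) \<le>
        (\<Sum>e\<in>E. ennreal (D * (g e u)\<^sup>2) * ennreal (exp (- real p * t e)))"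
      using D by (simp add: ennreal_leI sum_ennreal ennreal_mult[symmetric])
    have "?X t \<le> ennreal (2 * fact (2 * p) * ?K ^ p) * ?Z t"
      using \<beta> by (intro quenched_moment p) auto
    also have "\<dots> \<le> (\<Sum>e\<in>E. ennreal (D * (g e u)\<^sup>2) * ennreal (exp (- real p * t e))) * ?Z t"
      by (intro mult_right_mono K) simp
    finally have "?P t * ?X t \<le>
        ?P t * ((\<Sum>e\<in>E. ennreal (D * (g e u)\<^sup>2) * ennreal (exp (- real p * t e))) * ?Z t)"
      by (intro mult_left_mono) auto
    also have "\<dots> = (\<Sum>e\<in>E. ennreal (D * (g e u)\<^sup>2) * ?w e t)"
      by (simp add: sum_distrib_left sum_distrib_right mult_ac)
    finally show ?thesis .
  qed
  then have "(\<integral>\<^sup>+t. ?P t * ?X t \<partial>?M) \<le> (\<integral>\<^sup>+t. (\<Sum>e\<in>E. ennreal (D * (g e u)\<^sup>2) * ?w e t) \<partial>?M)"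
    by (intro nn_integral_mono)
  also have "\<dots> = (\<Sum>e\<in>E. (\<integral>\<^sup>+t. ennreal (D * (g e u)\<^sup>2) * ?w e t \<partial>?M))"
    by (intro nn_integral_sum borel_measurable_times_ennreal borel_measurable_const w)
  also have "\<dots> = (\<Sum>e\<in>E. ennreal (D * (g e u)\<^sup>2) * (\<integral>\<^sup>+t. ?w e t \<partial>?M))"
    by (intro sum.cong refl nn_integral_cmult w)
  also have "\<dots> \<le> (\<Sum>e\<in>E. ennreal (D * (g e u)\<^sup>2) * (ennreal C * ?I))"
    using \<beta> by (intro sum_mono mult_left_mono edge_moment[OF _ _ r r0 C]) auto
  also have "\<dots> = (\<Sum>e\<in>E. ennreal (D * (g e u)\<^sup>2)) * ennreal C * ?I"
    by (simp only: sum_distrib_right mult.assoc)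
  also have "(\<Sum>e\<in>E. ennreal (D * (g e u)\<^sup>2)) * ennreal C = ennreal (D * G * C)"
    using D C0 G by (simp add: sum_ennreal G_def sum_distrib_left ennreal_mult[symmetric] sum_nonneg)
  also have "D * G * C = 2 * fact (2 * p) / \<beta> ^ p * C * G ^ p"
    by (simp add: D_def n)
  finally show ?thesis unfolding G_def .
qed

end

section \<open>Negative moments of the stable density\<close>

text \<open>
  A discrete form of the identity between \<open>x powr (- q)\<close> and the integral over \<open>s\<close> of
  \<open>s powr (q - 1) * exp (- s * x) / Gamma q\<close>: the term with index \<open>\<lfloor>1 / x\<rfloor>\<close> alone suffices, because its
  exponential is at least \<open>exp (- 1)\<close>.  It expresses negative moments through the values of the Laplace
  transform at the natural numbers.
\<close>

lemma negative_power_le_suminf: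
  assumes x: "0 < (x::real)"
  shows "ennreal (1 / x ^ q) \<le> (\<Sum>n. ennreal (exp 1 * (real n + 1) ^ q * exp (- real n * x)))"
proof -
  define n where "n = nat \<lfloor>1 / x\<rfloor>"
  have "0 \<le> 1 / x" using x by simp
  then have n: "real n \<le> 1 / x" "1 / x \<le> real n + 1" unfolding n_def by linarith+
  have "1 / x ^ q = (1 / x) ^ q" by (simp add: power_divide)
  also have "\<dots> \<le> (real n + 1) ^ q" using n x by (intro power_mono) auto
  also have "\<dots> \<le> (real n + 1) ^ q * exp (1 - real n * x)"
    using n(1) x by (simp add: field_simps)
  also have "\<dots> = exp 1 * (real n + 1) ^ q * exp (- real n * x)"
    by (simp add: exp_diff exp_minus field_simps)
  finally have "ennreal (1 / x ^ q) \<le> ennreal (exp 1 * (real n + 1) ^ q * exp (- real n * x))"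
    by (rule ennreal_leI)
  also have "\<dots> = (\<Sum>n\<in>{n}. ennreal (exp 1 * (real n + 1) ^ q * exp (- real n * x)))"
    by (simp only: sum.insert[OF finite.emptyI] sum.empty empty_iff not_False_eq_True add_0_right)
  also have "\<dots> \<le> (\<Sum>n. ennreal (exp 1 * (real n + 1) ^ q * exp (- real n * x)))"
    by (rule sum_le_suminf) (rule summableI, simp, rule zero_le)
  finally show ?thesis .
qed

lemma summable_stretched_exponential:
  assumes "0 < \<alpha>"
  shows "summable (\<lambda>n. (real n + 1) ^ q * exp (- (real n powr \<alpha>)))"
proof -
  have "((\<lambda>n. (real n + 1) ^ q * exp (- (real n powr \<alpha>)) * real n ^ 2) \<longlongrightarrow> 0) at_top"
    using assms by real_asymp
  then have "\<forall>\<^sub>F n in at_top. norm ((real n + 1) ^ q * exp (- (real n powr \<alpha>)) * real n ^ 2) < 1"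
    by (auto dest: tendstoD[of _ _ _ 1])
  then have "\<forall>\<^sub>F n in at_top. norm ((real n + 1) ^ q * exp (- (real n powr \<alpha>))) \<le> inverse (real n ^ 2)"
    using eventually_gt_at_top[of 0]
    by eventually_elim (simp add: field_simps abs_mult)
  then show ?thesis
    by (rule summable_comparison_test_ev) (rule inverse_power_summable, simp)
qed

lemma stable_density_borel:
  assumes "stable_density \<alpha> f"
  shows "(\<lambda>x. indicator {0<..} x * f x) \<in> borel_measurable borel"
  using assms by (simp add: stable_density_def set_borel_measurable_def)

text \<open>
  The Bochner integral of a nonintegrable function is \<open>0\<close>, whereas the prescribed value
  is positive.  So the defining equation also carries integrability.
\<close>

lemma stable_density_laplace:
  assumes f: "stable_density \<alpha> f" and s: "0 \<le> s"
  shows "(\<integral>\<^sup>+x. ennreal (exp (- s * x) * (indicator {0<..} x * f x)) \<partial>lborel) = ennreal (exp (- (s powr \<alpha>)))"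
proof -
  let ?h = "\<lambda>x. indicator {0<..} x *\<^sub>R (exp (- s * x) * f x)"
  have int: "integral\<^sup>L lborel ?h = exp (- (s powr \<alpha>))"
    using f s by (simp add: stable_density_def set_lebesgue_integral_def)
  then have "integrable lborel ?h"
    using not_integrable_integral_eq[of lborel ?h] exp_not_eq_zero by metis
  moreover have "0 \<le> ?h x" for x
    using f by (auto simp: stable_density_def indicator_def less_imp_le)
  ultimately have "(\<integral>\<^sup>+x. ennreal (?h x) \<partial>lborel) = ennreal (exp (- (s powr \<alpha>)))"
    unfolding int[symmetric] by (intro nn_integral_eq_integral) auto
  then show ?thesis by (simp add: mult.left_commute)
qed

text \<open>
  The Laplace transform \<open>exp (- (s powr \<alpha>))\<close> decays faster than every power of \<open>s\<close>.
\<close>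

lemma stable_density_negative_moment:
  assumes f: "stable_density \<alpha> f" and \<alpha>: "0 < \<alpha>"
  shows "(\<integral>\<^sup>+x. ennreal (1 / x ^ q * (indicator {0<..} x * f x)) \<partial>lborel) < \<infinity>"
proof -
  let ?h = "\<lambda>x. indicator {0<..} x * f x"
  let ?c = "\<lambda>n. exp 1 * (real n + 1) ^ q"
  note [measurable] = stable_density_borel[OF f]
  have h: "0 \<le> ?h x" for x
    using f by (auto simp: stable_density_def indicator_def less_imp_le)
  have "ennreal (1 / x ^ q * ?h x) \<le> (\<Sum>n. ennreal (?c n) * ennreal (exp (- real n * x) * ?h x))" for x
  proof (cases "0 < x")
    case True
    have "ennreal (1 / x ^ q * ?h x) = ennreal (1 / x ^ q) * ennreal (?h x)"
      using True by (intro ennreal_mult h) simp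
    also have "\<dots> \<le> (\<Sum>n. ennreal (?c n * exp (- real n * x))) * ennreal (?h x)"
      by (intro mult_right_mono negative_power_le_suminf True) simp
    also have "\<dots> = (\<Sum>n. ennreal (?c n * exp (- real n * x)) * ennreal (?h x))"
      by (rule ennreal_suminf_multc[symmetric])
    also have "\<dots> = (\<Sum>n. ennreal (?c n) * ennreal (exp (- real n * x) * ?h x))"
      using h by (intro suminf_cong) (simp only: ennreal_mult[symmetric] mult.assoc mult_nonneg_nonneg
          exp_ge_zero of_nat_0_le_iff add_nonneg_nonneg zero_le_one zero_le_power)
    finally show ?thesis .
  qed simp
  then have "(\<integral>\<^sup>+x. ennreal (1 / x ^ q * ?h x) \<partial>lborel) \<le>
      (\<integral>\<^sup>+x. (\<Sum>n. ennreal (?c n) * ennreal (exp (- real n * x) * ?h x)) \<partial>lborel)"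
    by (intro nn_integral_mono)
  also have "\<dots> = (\<Sum>n. \<integral>\<^sup>+x. ennreal (?c n) * ennreal (exp (- real n * x) * ?h x) \<partial>lborel)"
    by (rule nn_integral_suminf) measurable
  also have "\<dots> = (\<Sum>n. ennreal (?c n) * ennreal (exp (- (real n powr \<alpha>))))"
  proof (rule suminf_cong)
    fix n
    have "(\<integral>\<^sup>+x. ennreal (?c n) * ennreal (exp (- real n * x) * ?h x) \<partial>lborel) =
        ennreal (?c n) * (\<integral>\<^sup>+x. ennreal (exp (- real n * x) * ?h x) \<partial>lborel)"
      by (rule nn_integral_cmult) measurable
    then show "(\<integral>\<^sup>+x. ennreal (?c n) * ennreal (exp (- real n * x) * ?h x) \<partial>lborel) =
        ennreal (?c n) * ennreal (exp (- (real n powr \<alpha>)))"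
      using stable_density_laplace[OF f, of "real n"] by simp
  qed
  also have "\<dots> = (\<Sum>n. ennreal (exp 1 * ((real n + 1) ^ q * exp (- (real n powr \<alpha>)))))"
    by (simp add: ennreal_mult[symmetric] mult.assoc)
  also have "\<dots> = ennreal (\<Sum>n. exp 1 * ((real n + 1) ^ q * exp (- (real n powr \<alpha>))))"
    by (intro suminf_ennreal2 summable_mult summable_stretched_exponential \<alpha>) auto
  also have "\<dots> < \<infinity>" by (simp only: ennreal_less_top infinity_ennreal_def)
  finally show ?thesis .
qed

text \<open>
  All that one edge contributes to the weight apart from the field: the stable density, the Jacobian
  of \<open>\<tau> \<mapsto> exp \<tau>\<close>, and the term \<open>exp \<tau>\<close> of the action.
\<close>

definition log_density :: "(real \<Rightarrow> real) \<Rightarrow> real \<Rightarrow> real" where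
  "log_density f \<tau> = f (exp \<tau>) * exp \<tau> * exp (- exp \<tau>)"

lemma log_density_pos: "stable_density \<alpha> f \<Longrightarrow> 0 < log_density f \<tau>"
  by (simp add: log_density_def stable_density_def)

lemma log_density_measurable:
  assumes "stable_density \<alpha> f"
  shows "log_density f \<in> borel_measurable lborel"
proof -
  note [measurable] = stable_density_borel[OF assms]
  have "(\<lambda>\<tau>. (\<lambda>x. indicator {0<..} x * f x) (exp \<tau>) * exp \<tau> * exp (- exp \<tau>)) \<in> borel_measurable lborel"
    by measurable
  then show ?thesis by (simp add: log_density_def[abs_def])
qed

text \<open>
  The substitution \<open>x = exp \<tau>\<close> leads back to a negative moment of the stable density.
\<close>

lemma log_density_negative_moment:
  assumes f: "stable_density \<alpha> f" and \<alpha>: "0 < \<alpha>"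
  shows "(\<integral>\<^sup>+\<tau>. ennreal (log_density f \<tau> * exp (- real q * \<tau>)) \<partial>lborel) < \<infinity>"
proof -
  let ?F = "\<lambda>x. 1 / x ^ q * (f x * exp (- x))"
  note [measurable] = stable_density_borel[OF f] log_density_measurable[OF f]
  have pos: "0 < f x" if "0 < x" for x using f that by (simp add: stable_density_def)
  let ?G = "\<lambda>x. 1 / x ^ q * (indicator {0<..} x * f x) * exp (- x)"
  have G: "integrable lborel ?G"
  proof (rule integrableI_bounded)
    have "(\<integral>\<^sup>+x. ennreal (norm (?G x)) \<partial>lborel) \<le>
        (\<integral>\<^sup>+x. ennreal (1 / x ^ q * (indicator {0<..} x * f x)) \<partial>lborel)"
    proof (intro nn_integral_mono ennreal_leI)
      fix x :: real
      show "norm (?G x) \<le> 1 / x ^ q * (indicator {0<..} x * f x)"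
        using pos[of x] by (cases "0 < x") (auto simp: abs_mult divide_simps)
    qed
    also have "\<dots> < \<infinity>" by (rule stable_density_negative_moment[OF f \<alpha>])
    finally show "(\<integral>\<^sup>+x. ennreal (norm (?G x)) \<partial>lborel) < \<infinity>" .
  qed measurable
  then have "integrable (completion lborel) ?G"
    by (subst integrable_completion) measurable
  then have "?F absolutely_integrable_on {0<..}"
    by (simp add: set_integrable_def mult_ac)
  moreover have "range exp = {0::real<..}"
  proof -
    have "x \<in> range exp" if "0 < x" for x :: real
      using that by (intro image_eqI[of _ _ "ln x"]) auto
    then show ?thesis by auto
  qed
  ultimately have "?F absolutely_integrable_on range exp" by (simp only:)
  then have "(\<lambda>\<tau>. \<bar>exp \<tau>\<bar> * ?F (exp \<tau>)) absolutely_integrable_on UNIV"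
    using has_absolute_integral_change_of_variables_1'[of UNIV exp exp ?F "integral (range exp) ?F"]
    by (auto intro!: derivative_eq_intros simp: inj_on_def)
  also have "(\<lambda>\<tau>. \<bar>exp \<tau>\<bar> * ?F (exp \<tau>)) = (\<lambda>\<tau>. log_density f \<tau> * exp (- real q * \<tau>))"
    by (rule ext) (simp add: log_density_def exp_minus exp_of_nat_mult[symmetric] field_simps)
  finally have "integrable (completion lborel) (\<lambda>\<tau>. log_density f \<tau> * exp (- real q * \<tau>))"
    by (simp add: set_integrable_def)
  then have "integrable lborel (\<lambda>\<tau>. log_density f \<tau> * exp (- real q * \<tau>))"
    by (subst (asm) integrable_completion) measurable
  then show ?thesis
    using log_density_pos[OF f] by (simp add: integrable_iff_bounded less_imp_le)
qed

text \<open>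
  This is the comparison of one-edge integrals that \<open>edge_moment\<close> requires.  The left-hand
  side is finite by the negative moments, and the integral on the right is positive because the density is.
\<close>

lemma log_density_tilt:
  assumes f: "stable_density \<alpha> f" and \<alpha>: "0 < \<alpha>"
  obtains C where "0 \<le> C"
    and "(\<integral>\<^sup>+\<tau>. ennreal (log_density f \<tau>) *
        ennreal (exp (- real p * \<tau>) * (1 + 16 * exp (- 4 * \<tau>))) \<partial>lborel)
      \<le> ennreal C * (\<integral>\<^sup>+\<tau>. ennreal (log_density f \<tau>) * indicator {..0} \<tau> \<partial>lborel)"
proof -
  let ?r = "log_density f"
  define M where "M = (\<integral>\<^sup>+\<tau>. ennreal (?r \<tau>) *
      ennreal (exp (- real p * \<tau>) * (1 + 16 * exp (- 4 * \<tau>))) \<partial>lborel)"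
  define m where "m = (\<integral>\<^sup>+\<tau>. ennreal (?r \<tau>) * indicator {..0} \<tau> \<partial>lborel)"
  note [measurable] = log_density_measurable[OF f]
  have r: "0 < ?r \<tau>" for \<tau> by (rule log_density_pos[OF f])
  have "M = (\<integral>\<^sup>+\<tau>. ennreal (?r \<tau> * exp (- real p * \<tau>)) +
      ennreal 16 * ennreal (?r \<tau> * exp (- real (p + 4) * \<tau>)) \<partial>lborel)"
    unfolding M_def
  proof (rule nn_integral_cong)
    fix \<tau>
    have "exp (- real (p + 4) * \<tau>) = exp (- real p * \<tau>) * exp (- 4 * \<tau>)"
      by (simp add: exp_add[symmetric] algebra_simps)
    then have "?r \<tau> * (exp (- real p * \<tau>) * (1 + 16 * exp (- 4 * \<tau>))) =
        ?r \<tau> * exp (- real p * \<tau>) + 16 * (?r \<tau> * exp (- real (p + 4) * \<tau>))"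
      by (simp only: distrib_left mult_ac mult_1_right)
    moreover have "ennreal (?r \<tau>) * ennreal (exp (- real p * \<tau>) * (1 + 16 * exp (- 4 * \<tau>))) =
        ennreal (?r \<tau> * (exp (- real p * \<tau>) * (1 + 16 * exp (- 4 * \<tau>))))"
      using r[of \<tau>] by (intro ennreal_mult[symmetric]) (auto intro!: add_nonneg_nonneg mult_nonneg_nonneg)
    moreover have "ennreal 16 * ennreal (?r \<tau> * exp (- real (p + 4) * \<tau>)) =
        ennreal (16 * (?r \<tau> * exp (- real (p + 4) * \<tau>)))"
      using r[of \<tau>] by (intro ennreal_mult[symmetric]) auto
    ultimately show "ennreal (?r \<tau>) * ennreal (exp (- real p * \<tau>) * (1 + 16 * exp (- 4 * \<tau>))) =
        ennreal (?r \<tau> * exp (- real p * \<tau>)) + ennreal 16 * ennreal (?r \<tau> * exp (- real (p + 4) * \<tau>))"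
      using r[of \<tau>] by (simp only: ennreal_plus[symmetric] mult_nonneg_nonneg exp_ge_zero less_imp_le zero_le_numeral)
  qed
  also have "\<dots> = (\<integral>\<^sup>+\<tau>. ennreal (?r \<tau> * exp (- real p * \<tau>)) \<partial>lborel) +
      (\<integral>\<^sup>+\<tau>. ennreal 16 * ennreal (?r \<tau> * exp (- real (p + 4) * \<tau>)) \<partial>lborel)"
    by (rule nn_integral_add) measurable
  also have "(\<integral>\<^sup>+\<tau>. ennreal 16 * ennreal (?r \<tau> * exp (- real (p + 4) * \<tau>)) \<partial>lborel) =
      ennreal 16 * (\<integral>\<^sup>+\<tau>. ennreal (?r \<tau> * exp (- real (p + 4) * \<tau>)) \<partial>lborel)"
    by (rule nn_integral_cmult) measurable
  finally have "M < \<infinity>"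
    using log_density_negative_moment[OF f \<alpha>, of p] log_density_negative_moment[OF f \<alpha>, of "p + 4"]
    by (simp add: ennreal_mult_less_top)
  then obtain a where a: "M = ennreal a" "0 \<le> a" by (cases M) auto
  have "m \<le> (\<integral>\<^sup>+\<tau>. ennreal (?r \<tau> * exp (- real 0 * \<tau>)) \<partial>lborel)"
    unfolding m_def by (intro nn_integral_mono) (auto simp: indicator_def)
  also have "\<dots> < \<infinity>" by (rule log_density_negative_moment[OF f \<alpha>])
  finally obtain b where b: "m = ennreal b" "0 \<le> b" by (cases m) auto
  have "m \<noteq> 0"
  proof
    assume "m = 0"
    then have "AE \<tau> in lborel. ennreal (?r \<tau>) * indicator {..0} \<tau> = 0"
      unfolding m_def by (subst (asm) nn_integral_0_iff_AE) measurable
    then have "AE \<tau> in lborel. (\<tau>::real) \<notin> {-1..0}"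
      by eventually_elim (use r in \<open>auto simp: indicator_def ennreal_eq_0_iff not_le[symmetric]\<close>)
    then have "emeasure lborel {-1..0::real} = 0"
      by (subst (asm) AE_iff_measurable[of "{-1..0}"]) auto
    then show False by simp
  qed
  with b have b0: "0 < b" by (auto simp: less_le)
  have "M = ennreal (a / b * b)" using a b0 by simp
  also have "\<dots> = ennreal (a / b) * m" unfolding b(1) using a b by (intro ennreal_mult) auto
  finally show thesis using that[of "a / b"] a b unfolding M_def m_def by simp
qed

section \<open>The Laplacian of the torus\<close>

text \<open>
  An arbitrary orientation of each edge.  It splits the quadratic \<open>grad_sq\<close> into linear gradients; only
  squares and products of two gradients of the same edge occur, so the choice is immaterial.
\<close>

definition edge_ends :: "'v set \<Rightarrow> 'v \<times> 'v" where
  "edge_ends e = (SOME p. e = {fst p, snd p})"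

definition edge_diff :: "'v set \<Rightarrow> ('v \<Rightarrow> real) \<Rightarrow> real" where
  "edge_diff e \<phi> = \<phi> (fst (edge_ends e)) - \<phi> (snd (edge_ends e))"

lemma edge_ends:
  assumes "e \<in> torus_edges a N"
  shows "e = {fst (edge_ends e), snd (edge_ends e)}"
proof -
  obtain x y where "e = {x, y}" using assms by (auto simp: torus_edges_def)
  then show ?thesis
    unfolding edge_ends_def by (intro someI[of "\<lambda>p. e = {fst p, snd p}" "(x, y)"]) simp
qed

lemma grad_sq_eq_edge_diff: "e \<in> torus_edges a N \<Longrightarrow> grad_sq \<phi> e = (edge_diff e \<phi>)\<^sup>2"
  using grad_sq_edge[of \<phi> "fst (edge_ends e)" "snd (edge_ends e)"] edge_ends[of e a N]
  by (simp add: edge_diff_def)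

lemma linear_on_edge_diff:
  assumes "e \<in> torus_edges a N"
  shows "linear_on (cuboid a N) (edge_diff e)"
proof -
  have "fst (edge_ends e) \<in> cuboid a N" "snd (edge_ends e) \<in> cuboid a N"
    using torus_edges_subset[OF assms] edge_ends[OF assms] by blast+
  then show ?thesis
    by (intro linear_onI) (simp_all add: edge_diff_def algebra_simps)
qed

lemma linear_on_dot: "linear_on V (\<lambda>x. dot V x v)"
  by (intro linear_onI) (simp_all add: dot_def distrib_right sum.distrib sum_distrib_left mult.assoc)

lemma dot_commute: "dot V x y = dot V y x"
  by (simp add: dot_def mult.commute)

text \<open>
  Polarisation of the identity for the quadratic form: summation by parts in edge form.
\<close>

lemma dot_neg_laplacian_edges:
  "dot (cuboid a N) \<phi> (neg_laplacian a N u) = (\<Sum>e\<in>torus_edges a N. edge_diff e \<phi> * edge_diff e u)"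
proof -
  let ?L = "neg_laplacian a N" and ?d = "dot (cuboid a N)"
  let ?s = "\<lambda>i. \<phi> i + u i"
  have Q: "?d x (?L x) = (\<Sum>e\<in>torus_edges a N. (edge_diff e x)\<^sup>2)" for x
    unfolding neg_laplacian_quadratic_form by (intro sum.cong) (simp_all add: grad_sq_eq_edge_diff)
  have add: "?d (\<lambda>i. x i + y i) z = ?d x z + ?d y z" for x y z
    by (rule linear_on_add[OF linear_on_dot])
  have sym: "?d x (?L y) = ?d y (?L x)" for x y
    using neg_laplacian_symmetric[of a N x y] by (simp only: dot_commute)
  have "?d ?s (?L ?s) = ?d \<phi> (?L ?s) + ?d u (?L ?s)" by (rule add)
  also have "\<dots> = ?d ?s (?L \<phi>) + ?d ?s (?L u)" by (simp only: sym[of _ ?s])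
  also have "\<dots> = ?d \<phi> (?L \<phi>) + ?d u (?L u) + 2 * ?d \<phi> (?L u)"
    using sym[of u \<phi>] by (simp add: add)
  finally have "2 * ?d \<phi> (?L u) = (\<Sum>e\<in>torus_edges a N. (edge_diff e ?s)\<^sup>2) -
      (\<Sum>e\<in>torus_edges a N. (edge_diff e \<phi>)\<^sup>2) - (\<Sum>e\<in>torus_edges a N. (edge_diff e u)\<^sup>2)"
    by (simp add: Q)
  also have "\<dots> = (\<Sum>e\<in>torus_edges a N. 2 * (edge_diff e \<phi> * edge_diff e u))"
    unfolding sum_subtractf[symmetric]
    by (intro sum.cong refl) (simp add: edge_diff_def power2_eq_square algebra_simps)
  finally show ?thesis by (simp add: sum_distrib_left[symmetric])
qed

lemma corner_in_cuboid: "a \<in> cuboid a N"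
  by (simp add: cuboid_def)

text \<open>
  The nearest-neighbour edges connect every point to the corner \<open>a\<close> by a path that lowers one
  coordinate at a time.
\<close>

lemma constant_on_cuboid:
  fixes x :: "int ^ 'd"
  assumes flat: "\<And>e. e \<in> torus_edges a N \<Longrightarrow> edge_diff e \<phi> = 0" and x: "x \<in> cuboid a N"
  shows "\<phi> x = \<phi> a"
  using x
proof (induction "nat (\<Sum>i\<in>UNIV. x $ i - a $ i)" arbitrary: x)
  case 0
  have "(\<Sum>i\<in>UNIV. x $ i - a $ i) = 0"
    using 0 by (intro antisym sum_nonneg) (auto simp: cuboid_def)
  then have "x $ i - a $ i = 0" for i
    using 0 by (subst (asm) sum_nonneg_eq_0_iff) (auto simp: cuboid_def)
  then show ?case by (metis eq_iff_diff_eq_0 vec_eq_iff)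
next
  case (Suc n)
  have "\<exists>i. x $ i \<noteq> a $ i"
  proof (rule ccontr)
    assume "\<not> ?thesis"
    then show False using Suc.hyps(2) by simp
  qed
  then obtain i where "x $ i \<noteq> a $ i" by blast
  with Suc.prems have i: "a $ i < x $ i"
    unfolding cuboid_def by (simp add: less_le)
  define y where "y = (\<chi> l. if l = i then x $ i - 1 else x $ l)"
  have y: "y \<in> cuboid a N"
    using Suc.prems i by (auto simp: cuboid_def y_def) (smt (verit))+
  have diff: "x $ l - y $ l = (if l = i then 1 else 0)" for l
    by (simp add: y_def)
  have "nearest_neighbours x y"
    unfolding nearest_neighbours_def diff by (simp add: if_distrib cong: if_cong)
  then have "{x, y} \<in> torus_edges a N"
    using y Suc.prems diff[of i] unfolding torus_edges_def by fastforce
  then have "grad_sq \<phi> {x, y} = 0"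
    by (simp add: grad_sq_eq_edge_diff flat)
  then have "\<phi> x = \<phi> y" by (simp add: grad_sq_edge)
  moreover have "(\<Sum>l\<in>UNIV. x $ l - y $ l) = 1"
    unfolding diff by simp
  then have "(\<Sum>l\<in>UNIV. y $ l - a $ l) = (\<Sum>l\<in>UNIV. x $ l - a $ l) - 1"
    by (simp add: sum_subtractf)
  then have "n = nat (\<Sum>l\<in>UNIV. y $ l - a $ l)"
    using Suc.hyps(2) by simp
  then have "\<phi> y = \<phi> a" using y by (rule Suc.hyps(1))
  ultimately show ?case by simp
qed

lemma flat_mean_zero:
  assumes "\<And>e. e \<in> torus_edges a N \<Longrightarrow> edge_diff e \<phi> = 0"
    and "(\<Sum>j\<in>cuboid a N. \<phi> j) = 0" and "j \<in> cuboid a N"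
  shows "\<phi> j = 0"
proof -
  have c: "\<phi> i = \<phi> a" if "i \<in> cuboid a N" for i
    using assms(1) that by (rule constant_on_cuboid)
  then have "real (card (cuboid a N)) * \<phi> a = 0" using assms(2) by simp
  moreover have "card (cuboid a N) \<noteq> 0"
    using corner_in_cuboid[of a N] finite_cuboid[of a N] by auto
  ultimately show ?thesis using c[OF assms(3)] by simp
qed

lemma inj_neg_laplacian: "inj_on (neg_laplacian a N) (mean_zero (cuboid a N))"
proof (rule inj_onI)
  fix u u' assume u: "u \<in> mean_zero (cuboid a N)" and u': "u' \<in> mean_zero (cuboid a N)"
    and eq: "neg_laplacian a N u = neg_laplacian a N u'"
  define w where "w = (\<lambda>i. u i - u' i)"
  have diff: "edge_diff e w = edge_diff e u - edge_diff e u'" for e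
    by (simp add: edge_diff_def w_def)
  have "(\<Sum>e\<in>torus_edges a N. edge_diff e w * edge_diff e u) =
      (\<Sum>e\<in>torus_edges a N. edge_diff e w * edge_diff e u')"
    using eq dot_neg_laplacian_edges[of a N w u] dot_neg_laplacian_edges[of a N w u'] by simp
  then have "(\<Sum>e\<in>torus_edges a N. (edge_diff e w)\<^sup>2) = 0"
    by (simp add: power2_eq_square diff right_diff_distrib sum_subtractf)
  then have flat: "edge_diff e w = 0" if "e \<in> torus_edges a N" for e
    using that by (subst (asm) sum_nonneg_eq_0_iff) (auto simp: finite_torus_edges)
  have "(\<Sum>j\<in>cuboid a N. w j) = 0"
    using u u' by (simp add: w_def mean_zero_def sum_subtractf)
  with flat have "w j = 0" if "j \<in> cuboid a N" for j
    using that by (rule flat_mean_zero)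
  then show "u = u'"
    using u u' by (intro PiE_ext[of u "cuboid a N" "\<lambda>_. UNIV" u']) (auto simp: w_def mean_zero_def)
qed

text \<open>
  Adding the square of \<open>\<Sum>j. x j\<close> makes the Dirichlet form positive definite on all of \<open>\<real>\<^sup>\<Lambda>\<close>.
  The representer of \<open>v\<close> for this form has mean zero, as testing with the constant function \<open>1\<close> shows,
  and then the extra term drops out again.
\<close>

lemma surj_neg_laplacian:
  fixes a :: "int ^ 'd"
  assumes v: "v \<in> mean_zero (cuboid a N)"
  shows "\<exists>u\<in>mean_zero (cuboid a N). neg_laplacian a N u = v"
proof -
  let ?V = "cuboid a N" and ?E = "torus_edges a N"
  define B where "B = (\<lambda>x y. (\<Sum>e\<in>?E. edge_diff e x * edge_diff e y) + (\<Sum>j\<in>?V. x j) * (\<Sum>j\<in>?V. y j))"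
  interpret energy_form ?V B
  proof
    show "finite ?V" by (rule finite_cuboid)
    show "B x y = B y x" for x y by (simp add: B_def mult.commute)
    show "linear_on ?V (\<lambda>x. B x z)" for z
    proof (rule linear_onI)
      show "B (\<lambda>i. x i + y i) z = B x z + B y z" for x y
        by (simp add: B_def linear_on_add[OF linear_on_edge_diff] distrib_right sum.distrib)
      show "B (\<lambda>i. c * x i) z = c * B x z" for c x
        by (simp add: B_def linear_on_scale[OF linear_on_edge_diff] distrib_left
            sum_distrib_left[symmetric] mult.assoc)
      show "B x z = B y z" if "\<And>i. i \<in> ?V \<Longrightarrow> x i = y i" for x y
        using that linear_on_cong[OF linear_on_edge_diff, of _ a N x y] by (simp add: B_def)
    qed
    show "0 < B x x" if nz: "\<exists>i\<in>?V. x i \<noteq> 0" for x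
    proof (rule ccontr)
      assume "\<not> ?thesis"
      moreover have 1: "0 \<le> (\<Sum>e\<in>?E. edge_diff e x * edge_diff e x)" by (simp add: sum_nonneg)
      moreover have 2: "0 \<le> (\<Sum>j\<in>?V. x j) * (\<Sum>j\<in>?V. x j)" by simp
      ultimately have 3: "(\<Sum>e\<in>?E. edge_diff e x * edge_diff e x) = 0" "(\<Sum>j\<in>?V. x j) * (\<Sum>j\<in>?V. x j) = 0"
        unfolding B_def by linarith+
      have flat: "edge_diff e x = 0" if "e \<in> ?E" for e
        using 3(1) that by (subst (asm) sum_nonneg_eq_0_iff) (auto simp: finite_torus_edges)
      have "(\<Sum>j\<in>?V. x j) = 0" using 3(2) by simp
      with flat have "x j = 0" if "j \<in> ?V" for j
        using that by (rule flat_mean_zero)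
      then show False using nz by blast
    qed
  qed
  obtain w where w: "\<And>x. B x w = dot ?V x v" using riesz[OF linear_on_dot] by blast
  have "B (\<lambda>_. 1) w = real (card ?V) * (\<Sum>j\<in>?V. w j)"
    by (simp add: B_def edge_diff_def)
  moreover have "dot ?V (\<lambda>_. 1) v = 0" using v by (simp add: dot_def mean_zero_def)
  moreover have "card ?V \<noteq> 0"
    using corner_in_cuboid[of a N] finite_cuboid[of a N] by auto
  ultimately have w0: "(\<Sum>j\<in>?V. w j) = 0" using w[of "\<lambda>_. 1"] by simp
  define u where "u = restrict w ?V"
  have u: "u \<in> mean_zero ?V" using w0 by (simp add: u_def mean_zero_def)
  have diff: "edge_diff e u = edge_diff e w" if "e \<in> ?E" for e
    by (intro linear_on_cong[OF linear_on_edge_diff[OF that]]) (simp add: u_def)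
  have "dot ?V x (neg_laplacian a N u) = dot ?V x v" for x
    using w[of x] w0 by (simp add: dot_neg_laplacian_edges B_def diff)
  moreover have "dot ?V (\<lambda>i. of_bool (i = j)) y = y j" if "j \<in> ?V" for y :: "int ^ 'd \<Rightarrow> real" and j
    using that finite_cuboid[of a N] by (simp add: dot_def of_bool_def if_distrib if_distribR cong: if_cong)
  ultimately have "neg_laplacian a N u j = v j" if "j \<in> ?V" for j
    using that by metis
  then have "neg_laplacian a N u = v"
    using v by (intro extensionalityI[of _ ?V]) (auto simp: neg_laplacian_def mean_zero_def PiE_def)
  then show ?thesis using u by blast
qed

lemma neg_laplacian_green:
  assumes "v \<in> mean_zero (cuboid a N)"
  shows "neg_laplacian a N (green a N v) = v"
  unfolding green_def
proof (rule f_the_inv_into_f[OF inj_neg_laplacian])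
  show "v \<in> neg_laplacian a N ` mean_zero (cuboid a N)"
    using surj_neg_laplacian[OF assms] by blast
qed

lemma dot_green:
  assumes "v \<in> mean_zero (cuboid a N)"
  shows "dot (cuboid a N) v (green a N v) = (\<Sum>e\<in>torus_edges a N. (edge_diff e (green a N v))\<^sup>2)"
  using dot_neg_laplacian_edges[of a N "green a N v" "green a N v"]
  by (simp add: neg_laplacian_green[OF assms] dot_commute power2_eq_square)

section \<open>The moment bound\<close>

lemma network_torus: "0 < \<epsilon> \<Longrightarrow> network (cuboid a N) (torus_edges a N) edge_diff \<epsilon>"
  by unfold_locales (simp_all add: finite_cuboid finite_torus_edges linear_on_edge_diff)

text \<open>
  Moving the terms \<open>exp (t e)\<close> of the action into the single-edge factors leaves a Gaussian weight, so
  that integrating over \<open>\<phi>\<close> first becomes possible.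
\<close>

lemma weight_eq:
  assumes "0 < \<epsilon>"
  shows "weight f \<beta> \<epsilon> a N (\<phi>, t) = (\<Prod>e\<in>torus_edges a N. log_density f (t e)) *
    exp (- network.form (cuboid a N) (torus_edges a N) edge_diff \<epsilon> (\<lambda>e. \<beta> * exp (t e)) \<phi> \<phi>)"
proof -
  interpret network "cuboid a N" "torus_edges a N" edge_diff \<epsilon> by (rule network_torus[OF assms])
  have "action \<beta> \<epsilon> a N \<phi> t = (\<Sum>e\<in>torus_edges a N. exp (t e) +
      \<beta> * exp (t e) * (edge_diff e \<phi> * edge_diff e \<phi>)) + \<epsilon> * (\<Sum>j\<in>cuboid a N. \<phi> j * \<phi> j)"
    unfolding action_def
    by (intro arg_cong2[where f = "(+)"] sum.cong refl)
      (simp_all add: grad_sq_eq_edge_diff power2_eq_square algebra_simps)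
  then have "action \<beta> \<epsilon> a N \<phi> t = (\<Sum>e\<in>torus_edges a N. exp (t e)) + form (\<lambda>e. \<beta> * exp (t e)) \<phi> \<phi>"
    by (simp add: form_def sum.distrib)
  then have "exp (- action \<beta> \<epsilon> a N \<phi> t) =
      exp (- (\<Sum>e\<in>torus_edges a N. exp (t e))) * exp (- form (\<lambda>e. \<beta> * exp (t e)) \<phi> \<phi>)"
    by (simp add: exp_add[symmetric])
  also have "exp (- (\<Sum>e\<in>torus_edges a N. exp (t e))) = (\<Prod>e\<in>torus_edges a N. exp (- exp (t e)))"
    unfolding sum_negf[symmetric] by (rule exp_sum[OF finite_torus_edges])
  finally show ?thesis
    by (simp add: weight_def log_density_def prod.distrib mult_ac)
qed

theorem theorem2p2:
  fixes \<alpha> \<beta> :: real and f :: "real \<Rightarrow> real" and p :: nat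
  assumes "0 < \<alpha>" and "\<alpha> < 1/2" and "0 < \<beta>"
    and "stable_density \<alpha> f"
    and "1 \<le> p"
  shows "\<exists>C::real. \<forall>(a :: int ^ 'd) (N :: nat ^ 'd) (\<epsilon> :: real) (v :: int ^ 'd \<Rightarrow> real).
    0 < \<epsilon> \<longrightarrow> v \<in> mean_zero (cuboid a N) \<longrightarrow>
      integrable (gibbs_measure f \<beta> \<epsilon> a N) (\<lambda>(\<phi>, t). dot (cuboid a N) \<phi> v ^ (2 * p)) \<and>
      (\<integral>(\<phi>, t). dot (cuboid a N) \<phi> v ^ (2 * p) \<partial>gibbs_measure f \<beta> \<epsilon> a N)
        \<le> C * dot (cuboid a N) v (green a N v) ^ p"
proof -
  let ?r = "log_density f"
  note r = log_density_measurable[OF assms(4)]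
  have r0: "0 \<le> ?r \<tau>" for \<tau> using log_density_pos[OF assms(4)] by (rule less_imp_le)
  obtain C0 where C0: "0 \<le> C0"
    and tilt: "(\<integral>\<^sup>+\<tau>. ennreal (?r \<tau>) * ennreal (exp (- real p * \<tau>) * (1 + 16 * exp (- 4 * \<tau>))) \<partial>lborel)
      \<le> ennreal C0 * (\<integral>\<^sup>+\<tau>. ennreal (?r \<tau>) * indicator {..0} \<tau> \<partial>lborel)"
    by (rule log_density_tilt[OF assms(4,1)])
  define C where "C = 2 * fact (2 * p) / \<beta> ^ p * C0"
  have C: "0 \<le> C" using C0 assms(3) by (simp add: C_def)
  show ?thesis
  proof (intro exI[of _ C] allI impI)
    fix a :: "int ^ 'd" and N :: "nat ^ 'd" and \<epsilon> :: real and v :: "int ^ 'd \<Rightarrow> real"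
    assume \<epsilon>: "0 < \<epsilon>" and v: "v \<in> mean_zero (cuboid a N)"
    let ?V = "cuboid a N" and ?E = "torus_edges a N" and ?u = "green a N v"
    interpret network ?V ?E edge_diff \<epsilon> by (rule network_torus[OF \<epsilon>])
    let ?M = "\<Pi>\<^sub>M i\<in>?V. (lborel :: real measure)" and ?T = "\<Pi>\<^sub>M e\<in>?E. (lborel :: real measure)"
    interpret MV: product_sigma_finite "\<lambda>_ :: int ^ 'd. lborel :: real measure" by standard
    interpret ME: product_sigma_finite "\<lambda>_ :: (int ^ 'd) set. lborel :: real measure" by standard
    interpret pair_sigma_finite ?M ?T
      by (intro pair_sigma_finite.intro MV.sigma_finite ME.sigma_finite finite_cuboid finite_torus_edges)
    let ?X = "\<lambda>(\<phi>, t). dot ?V \<phi> v ^ (2 * p)"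
    let ?c = "\<lambda>t e. \<beta> * exp (t e)"
    let ?P = "\<lambda>t. ennreal (\<Prod>e\<in>?E. ?r (t e))"
    let ?W = "\<lambda>\<omega>. ennreal (weight f \<beta> \<epsilon> a N \<omega>)"
    let ?G = "dot ?V v ?u"
    have P0: "0 \<le> (\<Prod>e\<in>?E. ?r (t e))" for t by (intro prod_nonneg r0)
    have G: "0 \<le> ?G" unfolding dot_green[OF v] by (simp add: sum_nonneg)
    have dot: "dot ?V \<phi> v = (\<Sum>e\<in>?E. edge_diff e \<phi> * edge_diff e ?u)" for \<phi>
      using dot_neg_laplacian_edges[of a N \<phi> ?u] by (simp add: neg_laplacian_green[OF v])
    have W: "?W (\<phi>, t) = ?P t * ennreal (exp (- form (?c t) \<phi> \<phi>))" for \<phi> t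
      unfolding weight_eq[OF \<epsilon>] by (intro ennreal_mult P0) simp
    have P: "?P \<in> borel_measurable ?T"
    proof -
      have "(\<lambda>t. t e) \<in> borel_measurable ?T" if "e \<in> ?E" for e
        using measurable_component_singleton[OF that, of "\<lambda>_. lborel"] by simp
      then show ?thesis
        by (intro measurable_compose[OF _ measurable_ennreal] borel_measurable_prod
            measurable_compose[of "\<lambda>t. t _" _ borel ?r]) (use r in simp_all)
    qed
    have Wm: "?W \<in> borel_measurable (?M \<Otimes>\<^sub>M ?T)"
    proof -
      have "(\<lambda>\<omega>. ?P (snd \<omega>) * (case \<omega> of (\<phi>, t) \<Rightarrow> ennreal (exp (- form (?c t) \<phi> \<phi>))))
          \<in> borel_measurable (?M \<Otimes>\<^sub>M ?T)"
        by (intro borel_measurable_times_ennreal measurable_weight measurable_compose[OF measurable_snd P])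
      moreover have "(\<lambda>\<omega>. ?P (snd \<omega>) * (case \<omega> of (\<phi>, t) \<Rightarrow> ennreal (exp (- form (?c t) \<phi> \<phi>)))) = ?W"
        by (rule ext) (auto simp: W)
      ultimately show ?thesis by simp
    qed
    have Xm: "?X \<in> borel_measurable (?M \<Otimes>\<^sub>M ?T)"
      unfolding case_prod_beta
      by (intro borel_measurable_power measurable_compose[OF measurable_fst
            linear_on_measurable[OF finite_cuboid linear_on_dot]])
    have X0: "0 \<le> ?X \<omega>" for \<omega> by (cases \<omega>) (simp add: zero_le_even_power)
    have form_m: "(\<lambda>\<phi>. form (?c t) \<phi> \<phi>) \<in> borel_measurable ?M" for t
      using assms(3) by (intro energy_form.measurable_energy energy_form_form) simp
    have part: "partition_function f \<beta> \<epsilon> a N = (\<integral>\<^sup>+t. ?P t * Z (?c t) \<partial>?T)"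
    proof -
      have inner: "(\<integral>\<^sup>+\<phi>. ?W (\<phi>, t) \<partial>?M) = ?P t * Z (?c t)" for t
        unfolding W Z_def using form_m[of t]
        by (intro nn_integral_cmult measurable_compose[OF _ measurable_ennreal]
            measurable_compose[OF _ borel_measurable_exp] borel_measurable_uminus)
      have "partition_function f \<beta> \<epsilon> a N = (\<integral>\<^sup>+t. (\<integral>\<^sup>+\<phi>. ?W (\<phi>, t) \<partial>?M) \<partial>?T)"
        unfolding partition_function_def reference_measure_def by (rule nn_integral_snd[OF Wm, symmetric])
      then show ?thesis by (simp only: inner)
    qed
    have num: "(\<integral>\<^sup>+\<omega>. ?W \<omega> * ennreal (?X \<omega>) \<partial>(?M \<Otimes>\<^sub>M ?T))
        \<le> ennreal (C * ?G ^ p) * partition_function f \<beta> \<epsilon> a N"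
    proof -
      have inner: "(\<integral>\<^sup>+\<phi>. ?W (\<phi>, t) * ennreal (?X (\<phi>, t)) \<partial>?M) = ?P t *
          (\<integral>\<^sup>+\<phi>. ennreal ((\<Sum>e\<in>?E. edge_diff e \<phi> * edge_diff e ?u) ^ (2 * p) *
            exp (- form (?c t) \<phi> \<phi>)) \<partial>?M)" for t
      proof -
        have "?W (\<phi>, t) * ennreal (?X (\<phi>, t)) =
            ?P t * ennreal (dot ?V \<phi> v ^ (2 * p) * exp (- form (?c t) \<phi> \<phi>))" for \<phi>
          unfolding W using X0[of "(\<phi>, t)"] by (simp add: ennreal_mult mult_ac)
        then show ?thesis
          unfolding dot[symmetric] using form_m[of t]
          by (simp only:, intro nn_integral_cmult measurable_compose[OF _ measurable_ennreal]
            borel_measurable_times borel_measurable_power linear_on_measurable[OF finite_cuboid linear_on_dot]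
            measurable_compose[OF _ borel_measurable_exp] borel_measurable_uminus)
      qed
      have "(\<integral>\<^sup>+\<omega>. ?W \<omega> * ennreal (?X \<omega>) \<partial>(?M \<Otimes>\<^sub>M ?T)) =
          (\<integral>\<^sup>+t. (\<integral>\<^sup>+\<phi>. ?W (\<phi>, t) * ennreal (?X (\<phi>, t)) \<partial>?M) \<partial>?T)"
        by (intro nn_integral_snd[symmetric] borel_measurable_times_ennreal Wm
            measurable_compose[OF Xm measurable_ennreal])
      also have "\<dots> = (\<integral>\<^sup>+t. ?P t * (\<integral>\<^sup>+\<phi>. ennreal ((\<Sum>e\<in>?E. edge_diff e \<phi> * edge_diff e ?u) ^ (2 * p) *
            exp (- form (?c t) \<phi> \<phi>)) \<partial>?M) \<partial>?T)"
        by (simp only: inner)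
      also have "\<dots> \<le> ennreal (C * ?G ^ p) * (\<integral>\<^sup>+t. ?P t * Z (?c t) \<partial>?T)"
        unfolding C_def dot_green[OF v]
        by (rule annealed_moment[OF assms(3,5) r r0 C0 tilt])
      finally show ?thesis unfolding part .
    qed
    have sets: "sets (gibbs_measure f \<beta> \<epsilon> a N) = sets (?M \<Otimes>\<^sub>M ?T)"
      by (simp add: gibbs_measure_def reference_measure_def)
    have "(\<integral>\<^sup>+\<omega>. ennreal (?X \<omega>) \<partial>gibbs_measure f \<beta> \<epsilon> a N) =
        (\<integral>\<^sup>+\<omega>. ?W \<omega> / partition_function f \<beta> \<epsilon> a N * ennreal (?X \<omega>) \<partial>(?M \<Otimes>\<^sub>M ?T))"
      unfolding gibbs_measure_def reference_measure_def
      by (intro nn_integral_density borel_measurable_divide_ennreal Wm borel_measurable_const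
          measurable_compose[OF Xm measurable_ennreal])
    also have "\<dots> = (\<integral>\<^sup>+\<omega>. ?W \<omega> * ennreal (?X \<omega>) / partition_function f \<beta> \<epsilon> a N \<partial>(?M \<Otimes>\<^sub>M ?T))"
      by (simp add: divide_ennreal_def mult_ac)
    also have "\<dots> = (\<integral>\<^sup>+\<omega>. ?W \<omega> * ennreal (?X \<omega>) \<partial>(?M \<Otimes>\<^sub>M ?T)) / partition_function f \<beta> \<epsilon> a N"
      by (intro nn_integral_divide borel_measurable_times_ennreal Wm
          measurable_compose[OF Xm measurable_ennreal])
    also have "\<dots> \<le> ennreal (C * ?G ^ p) * partition_function f \<beta> \<epsilon> a N / partition_function f \<beta> \<epsilon> a N"
      using num by (rule divide_right_mono_ennreal)
    \<comment> \<open>In the degenerate cases \<open>0 / 0\<close> and \<open>\<infinity> / \<infinity>\<close> the quotient is \<open>0\<close>, and the bound persists.\<close>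
    also have "\<dots> \<le> ennreal (C * ?G ^ p)"
      by (cases "partition_function f \<beta> \<epsilon> a N = 0 \<or> partition_function f \<beta> \<epsilon> a N = \<infinity>")
        (auto simp: ennreal_divide_times ennreal_mult_divide_eq)
    finally have bound: "(\<integral>\<^sup>+\<omega>. ennreal (?X \<omega>) \<partial>gibbs_measure f \<beta> \<epsilon> a N) \<le> ennreal (C * ?G ^ p)" .
    have int: "integrable (gibbs_measure f \<beta> \<epsilon> a N) ?X"
    proof (rule integrableI_nonneg)
      show "?X \<in> borel_measurable (gibbs_measure f \<beta> \<epsilon> a N)"
        using Xm by (simp add: measurable_cong_sets[OF sets refl])
      show "(\<integral>\<^sup>+\<omega>. ennreal (?X \<omega>) \<partial>gibbs_measure f \<beta> \<epsilon> a N) < \<infinity>"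
        using bound by (rule order.strict_trans1) simp
    qed (rule AE_I2, rule X0)
    have "(\<integral>\<^sup>+\<omega>. ennreal (?X \<omega>) \<partial>gibbs_measure f \<beta> \<epsilon> a N) =
        ennreal (integral\<^sup>L (gibbs_measure f \<beta> \<epsilon> a N) ?X)"
      by (rule nn_integral_eq_integral[OF int]) (rule AE_I2, rule X0)
    with bound have "ennreal (integral\<^sup>L (gibbs_measure f \<beta> \<epsilon> a N) ?X) \<le> ennreal (C * ?G ^ p)"
      by (simp only:)
    then have "integral\<^sup>L (gibbs_measure f \<beta> \<epsilon> a N) ?X \<le> C * ?G ^ p"
      using C G by (subst (asm) ennreal_le_iff) auto
    with int show "integrable (gibbs_measure f \<beta> \<epsilon> a N) ?X \<and>
        integral\<^sup>L (gibbs_measure f \<beta> \<epsilon> a N) ?X \<le> C * ?G ^ p" by simp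
  qed
qed

end
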